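(* For every compact group $G$, the Banach algebra $L^2(G)$ (with convolution product) is symmetrically pseudo-amenable.
   Context: For a Banach algebra $\mathfrak{U}$, $\mathfrak{U}\widehat{\otimes}\mathfrak{U}$ is the projective tensor product, with $a(b\otimes c)=ab\otimes c$, $(b\otimes c)a=b\otimes ca$, and $\pi(b\otimes c)=bc$ (extended linearly and continuously). The flip is $(b\otimes c)^{\circ}=c\otimes b$; $\mathbf{t}$ is symmetric if $\mathbf{t}^\circ=\mathbf{t}$. An approximate diagonal is a net $\{\mathbf{t}_\lambda\}$ in $\mathfrak{U}\widehat{\otimes}\mathfrak{U}$ (not necessarily bounded) with $a\mathbf{t}_\lambda-\mathbf{t}_\lambda a\to0$ and $\pi(\mathbf{t}_\lambda)a\to a$ for all $a\in\mathfrak{U}$. $\mathfrak{U}$ is symmetrically pseudo-amenable if it has an approximate diagonal consisting of symmetric elements. *)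

theory Defs
  imports "HOL-Analysis.Analysis"
begin

text \<open>Compact (Hausdorff) topological groups, written additively but NOT assumed
commutative (class group_add is non-commutative).\<close>

definition compact_group :: "'g::{group_add, t2_space} itself \<Rightarrow> bool" where
  "compact_group _ \<longleftrightarrow>
     continuous_on UNIV (\<lambda>p::'g \<times> 'g. fst p + snd p) \<and>
     continuous_on UNIV (\<lambda>x::'g. - x) \<and>
     compact (UNIV :: 'g set)"

definition haar_prob :: "'g::{group_add, topological_space} measure \<Rightarrow> bool" where
  "haar_prob \<mu> \<longleftrightarrow>
     sets \<mu> = sets borel \<and> space \<mu> = UNIV \<and> emeasure \<mu> UNIV = 1 \<and>
     (\<forall>g A. A \<in> sets borel \<longrightarrow> emeasure \<mu> ((+) g ` A) = emeasure \<mu> A) \<and>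
     (\<forall>A \<in> sets borel. emeasure \<mu> A = (INF U \<in> {U. open U \<and> A \<subseteq> U}. emeasure \<mu> U)) \<and>
     (\<forall>U. open U \<longrightarrow> emeasure \<mu> U = (SUP K \<in> {K. compact K \<and> K \<subseteq> U}. emeasure \<mu> K))"

definition L2 :: "'g measure \<Rightarrow> ('g \<Rightarrow> complex) set" where
  "L2 \<mu> = {f. f \<in> borel_measurable \<mu> \<and> integrable \<mu> (\<lambda>x. (cmod (f x))\<^sup>2)}"

definition l2norm :: "'g measure \<Rightarrow> ('g \<Rightarrow> complex) \<Rightarrow> real" where
  "l2norm \<mu> f = sqrt (\<integral>x. (cmod (f x))\<^sup>2 \<partial>\<mu>)"

definition conv :: "'g::group_add measure \<Rightarrow> ('g \<Rightarrow> complex) \<Rightarrow> ('g \<Rightarrow> complex) \<Rightarrow> 'g \<Rightarrow> complex" where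
  "conv \<mu> f g x = (\<integral>y. f y * g (- y + x) \<partial>\<mu>)"

text \<open>Elements of the projective tensor product L^2(G) (x)^ L^2(G) are represented
by sequences of pairs (b_n, c_n), standing for Sum b_n (x) c_n with
Sum |b_n| |c_n| < infinity; two representatives define the same tensor iff they
agree on every bounded bilinear form (the dual of the projective tensor product);
the projective norm is the infimum of Sum |b_n| |c_n| over all representations.\<close>

type_synonym 'g tens = "nat \<Rightarrow> ('g \<Rightarrow> complex) \<times> ('g \<Rightarrow> complex)"

definition tens_ok :: "'g measure \<Rightarrow> 'g tens \<Rightarrow> bool" where
  "tens_ok \<mu> t \<longleftrightarrow> (\<forall>n. fst (t n) \<in> L2 \<mu> \<and> snd (t n) \<in> L2 \<mu>) \<and>
     summable (\<lambda>n. l2norm \<mu> (fst (t n)) * l2norm \<mu> (snd (t n)))"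

definition bdd_bilinear :: "'g measure \<Rightarrow> (('g \<Rightarrow> complex) \<Rightarrow> ('g \<Rightarrow> complex) \<Rightarrow> complex) \<Rightarrow> bool" where
  "bdd_bilinear \<mu> \<phi> \<longleftrightarrow>
     (\<forall>f1\<in>L2 \<mu>. \<forall>f2\<in>L2 \<mu>. \<forall>g\<in>L2 \<mu>. \<forall>c::complex.
        \<phi> (\<lambda>x. c * f1 x + f2 x) g = c * \<phi> f1 g + \<phi> f2 g \<and>
        \<phi> g (\<lambda>x. c * f1 x + f2 x) = c * \<phi> g f1 + \<phi> g f2) \<and>
     (\<exists>C. \<forall>f\<in>L2 \<mu>. \<forall>g\<in>L2 \<mu>. cmod (\<phi> f g) \<le> C * l2norm \<mu> f * l2norm \<mu> g)"

definition tens_equiv :: "'g measure \<Rightarrow> 'g tens \<Rightarrow> 'g tens \<Rightarrow> bool" where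
  "tens_equiv \<mu> s t \<longleftrightarrow> tens_ok \<mu> s \<and> tens_ok \<mu> t \<and>
     (\<forall>\<phi>. bdd_bilinear \<mu> \<phi> \<longrightarrow>
        (\<Sum>n. \<phi> (fst (s n)) (snd (s n))) = (\<Sum>n. \<phi> (fst (t n)) (snd (t n))))"

definition proj_norm :: "'g measure \<Rightarrow> 'g tens \<Rightarrow> real" where
  "proj_norm \<mu> t = Inf {(\<Sum>n. l2norm \<mu> (fst (s n)) * l2norm \<mu> (snd (s n))) | s. tens_equiv \<mu> s t}"

definition lmult :: "'g::group_add measure \<Rightarrow> ('g \<Rightarrow> complex) \<Rightarrow> 'g tens \<Rightarrow> 'g tens" where
  "lmult \<mu> a t = (\<lambda>n. (conv \<mu> a (fst (t n)), snd (t n)))"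

definition rmult :: "'g::group_add measure \<Rightarrow> 'g tens \<Rightarrow> ('g \<Rightarrow> complex) \<Rightarrow> 'g tens" where
  "rmult \<mu> t a = (\<lambda>n. (fst (t n), conv \<mu> (snd (t n)) a))"

definition tens_diff :: "'g tens \<Rightarrow> 'g tens \<Rightarrow> 'g tens" where
  "tens_diff s t = (\<lambda>n. if even n then s (n div 2)
                         else ((\<lambda>x. - fst (t (n div 2)) x), snd (t (n div 2))))"

definition flip :: "'g tens \<Rightarrow> 'g tens" where
  "flip t = (\<lambda>n. prod.swap (t n))"

text \<open>pi(Sum b_n(x)c_n) = Sum b_n * c_n; on a compact group |b*c|_infinity <= |b|_2 |c|_2,
so the series converges absolutely at every point (and in L^2).\<close>

definition tens_pi :: "'g::group_add measure \<Rightarrow> 'g tens \<Rightarrow> 'g \<Rightarrow> complex" where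
  "tens_pi \<mu> t = (\<lambda>x. \<Sum>n. conv \<mu> (fst (t n)) (snd (t n)) x)"

text \<open>A net in a space is encoded, as usual, by a proper filter on it (every net
yields its image filter, and every proper filter is the image filter of a net).
Symmetric pseudo-amenability: there is an approximate diagonal consisting of
symmetric elements.\<close>

definition sym_pseudo_amenable_L2 :: "'g::group_add measure \<Rightarrow> bool" where
  "sym_pseudo_amenable_L2 \<mu> \<longleftrightarrow>
     (\<exists>F :: 'g tens filter. F \<noteq> bot \<and>
        (\<forall>\<^sub>F t in F. tens_ok \<mu> t \<and> tens_equiv \<mu> (flip t) t) \<and>
        (\<forall>a\<in>L2 \<mu>. ((\<lambda>t. proj_norm \<mu> (tens_diff (lmult \<mu> a t) (rmult \<mu> t a))) \<longlongrightarrow> 0) F) \<and>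
        (\<forall>a\<in>L2 \<mu>. ((\<lambda>t. l2norm \<mu> (\<lambda>x. conv \<mu> (tens_pi \<mu> t) a x - a x)) \<longlongrightarrow> 0) F))"

end

theory Submission
  imports Defs
begin

text \<open>For a continuous central density \<open>h\<close> near the identity, the tensor
  \<open>\<integral> h(- z + \<cdot>) \<otimes> h(z + \<cdot>) dz\<close> commutes with translations by invariance of Haar measure, hence
  with all of \<open>L\<^sup>2(G)\<close>, its flip is itself up to \<open>z \<mapsto> - z\<close>, and its product is \<open>h * h\<close>, an
  approximate unit. Symmetrised Riemann sums of this integral are finite symmetric tensors that
  commute approximately; the commutator is estimated by coupling the level sets of the
  discretization with their translates. Neither the Peter-Weyl theorem nor Fubini's theorem is used.\<close>

section \<open>Oscillation of continuous functions on compact groups\<close>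

text \<open>\<open>haar_prob\<close> grants left invariance only, whereas the flip calls for
  invariance under inversion and the right action for right translations, so both are derived first.
  Centrality of \<open>h\<close> lets a right translation of the second leg be written as a change
  of its index: the point mass at \<open>j\<close> sends \<open>ltr h z\<close> to
  \<open>ltr h (j + z)\<close> from the left and \<open>ltr h (- z)\<close> to
  \<open>ltr h (- z + j)\<close> from the right, and replacing \<open>z\<close> by
  \<open>j + z\<close> identifies the two resulting integrals. Since tensors are coded by sequences,
  that integral is never formed; only its Riemann sums are. The choices are ordered: finitely many
  \<open>a\<close> and a tolerance fix the support of \<open>h\<close>, then \<open>h\<close> has
  some supremum \<open>H\<close>, and \<open>H\<close> fixes the mesh. As \<open>H\<close> is not
  controlled when the support shrinks, no uniform bound on the tensors results, which
  pseudo-amenability tolerates. The mesh matters for the commutator alone: every node contributes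
  the same function \<open>h * h\<close> to the product, so that side carries no discretization
  error.\<close>

text \<open>Shifting on both sides makes this a conjugation-invariant length on the group. It serves
  at once as a modulus of uniform continuity for \<open>f\<close>, as a source of small
  neighbourhoods in a group without a metric, and as raw material for central functions.\<close>

definition osc :: "('g::group_add \<Rightarrow> 'b::metric_space) \<Rightarrow> 'g \<Rightarrow> real" where
  "osc f x = (SUP (y, z). dist (f (y + x + z)) (f (y + z)))"

lemmas group_norm = diff_conv_add_uminus add.assoc minus_add

locale compact_haar =
  fixes \<mu> :: "'g::{group_add, t2_space} measure"
  assumes grp: "compact_group TYPE('g)" and haar: "haar_prob \<mu>"
begin

lemma continuous_on_gadd:
  fixes f g :: "'a::topological_space \<Rightarrow> 'g"
  assumes "continuous_on S f" "continuous_on S g"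
  shows "continuous_on S (\<lambda>x. f x + g x)"
proof -
  have *: "continuous_on UNIV (\<lambda>p::'g \<times> 'g. fst p + snd p)"
    using grp by (simp add: compact_group_def)
  show ?thesis
    using continuous_on_compose2[OF * continuous_on_Pair[OF assms]] by simp
qed

lemma continuous_on_guminus:
  fixes f :: "'a::topological_space \<Rightarrow> 'g"
  assumes "continuous_on S f"
  shows "continuous_on S (\<lambda>x. - f x)"
proof -
  have *: "continuous_on UNIV (\<lambda>x::'g. - x)"
    using grp by (simp add: compact_group_def)
  show ?thesis
    using continuous_on_compose2[OF * assms] by simp
qed

lemma continuous_on_gdiff:
  fixes f g :: "'a::topological_space \<Rightarrow> 'g"
  assumes "continuous_on S f" "continuous_on S g"
  shows "continuous_on S (\<lambda>x. f x - g x)"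
  using continuous_on_gadd[OF assms(1) continuous_on_guminus[OF assms(2)]] by simp

lemmas group_cont = continuous_on_gadd continuous_on_guminus continuous_on_gdiff

lemma compact_group_UNIV: "compact (UNIV :: 'g set)"
  using grp by (simp add: compact_group_def)

lemma continuous_bounded:
  fixes f :: "'g \<Rightarrow> 'b::real_normed_vector"
  assumes "continuous_on UNIV f"
  obtains B where "B \<ge> 0" "\<And>x. norm (f x) \<le> B"
proof -
  have "bounded (range f)"
    using compact_continuous_image[OF assms compact_group_UNIV] compact_imp_bounded by blast
  then show ?thesis
    using that unfolding bounded_pos by (meson less_imp_le rangeI)
qed

context
  fixes f :: "'g \<Rightarrow> 'b::real_normed_vector"
  assumes f: "continuous_on UNIV f"
begin

text \<open>The content is that the supremum is taken over a bounded set: \<open>f\<close> is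
  bounded by compactness.\<close>

lemma dist_le_osc: "dist (f (y + x + z)) (f (y + z)) \<le> osc f x"
proof -
  obtain B where B: "\<And>x. norm (f x) \<le> B" using continuous_bounded[OF f] by metis
  have "dist (f a) (f b) \<le> B + B" for a b
    using norm_triangle_ineq4[of "f a" "f b"] B[of a] B[of b] by (simp add: dist_norm)
  then have "bdd_above (range (\<lambda>(y, z). dist (f (y + x + z)) (f (y + z))))"
    by (intro bdd_aboveI[of _ "B + B"]) auto
  from cSUP_upper[OF UNIV_I this, of "(y, z)"] show ?thesis
    by (simp add: osc_def)
qed

lemma osc_le:
  assumes "\<And>y z. dist (f (y + x + z)) (f (y + z)) \<le> c"
  shows "osc f x \<le> c"
  unfolding osc_def by (rule cSUP_least) (auto intro: assms)

lemma osc_nonneg: "0 \<le> osc f x"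
  using order_trans[OF zero_le_dist dist_le_osc] .

lemma osc_0: "osc f 0 = 0"
  by (rule antisym[OF osc_le osc_nonneg]) simp

lemma dist_le_osc_diff: "dist (f (y + x + z)) (f (y + x' + z)) \<le> osc f (x - x')"
  using dist_le_osc[of y "x - x'" "x' + z"] by (simp add: group_norm del: add_uminus_conv_diff)

text \<open>Remove \<open>x\<close> first and \<open>x'\<close> afterwards; the leftover
  \<open>x'\<close> is absorbed into the free right shift.\<close>

lemma osc_add: "osc f (x + x') \<le> osc f x + osc f x'"
proof (rule osc_le)
  fix y z
  have "dist (f (y + (x + x') + z)) (f (y + z))
      \<le> dist (f (y + x + (x' + z))) (f (y + (x' + z))) + dist (f (y + x' + z)) (f (y + z))"
    using dist_triangle[of "f (y + (x + x') + z)" "f (y + z)" "f (y + x' + z)"]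
    by (simp add: add.assoc)
  also have "\<dots> \<le> osc f x + osc f x'"
    by (intro add_mono dist_le_osc)
  finally show "dist (f (y + (x + x') + z)) (f (y + z)) \<le> osc f x + osc f x'" .
qed

lemma osc_uminus_le: "osc f (- x) \<le> osc f x"
proof (rule osc_le)
  fix y z
  show "dist (f (y + - x + z)) (f (y + z)) \<le> osc f x"
    using dist_le_osc[of "y - x" x z] by (simp add: dist_commute)
qed

lemma osc_uminus: "osc f (- x) = osc f x"
  using osc_uminus_le[of x] osc_uminus_le[of "- x"] by simp

text \<open>The conjugating elements are absorbed into the two free shifts, \<open>c\<close> into
  \<open>y\<close> and \<open>- c\<close> into \<open>z\<close>.\<close>

lemma osc_conj_le: "osc f (c + x - c) \<le> osc f x"
proof (rule osc_le)
  fix y z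
  show "dist (f (y + (c + x - c) + z)) (f (y + z)) \<le> osc f x"
    using dist_le_osc[of "y + c" x "- c + z"] by (simp add: group_norm del: add_uminus_conv_diff)
qed

lemma osc_conj: "osc f (c + x - c) = osc f x"
proof (rule antisym[OF osc_conj_le])
  show "osc f x \<le> osc f (c + x - c)"
    using osc_conj_le[of "- c" "c + x - c"] by (simp add: group_norm del: add_uminus_conv_diff)
qed

lemma osc_swap: "osc f (x + y) = osc f (y + x)"
  using osc_conj[of y "x + y"] by (simp add: group_norm del: add_uminus_conv_diff)

text \<open>Left and right differences have the same length, so the left and right uniformities need
  not be distinguished below.\<close>

lemma osc_flip: "osc f (- x + y) = osc f (x - y)"
  using osc_uminus[of "x - y"] osc_swap[of "- x" y] by simp

text \<open>Uniform continuity by the tube lemma: the pairs of shifts form a compact space, so an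
  open condition that holds on the slice over \<open>0\<close> holds over a whole neighbourhood of
  \<open>0\<close>.\<close>

lemma osc_nbhd:
  assumes "e > 0"
  obtains V where "open V" "0 \<in> V" "\<And>v. v \<in> V \<Longrightarrow> osc f v < e"
proof -
  \<comment> \<open>Half of \<open>e\<close>, because passing to the supremum weakens the strict
    inequality.\<close>
  let ?W = "{p :: 'g \<times> 'g \<times> 'g. dist (f (fst (snd p) + fst p + snd (snd p))) (f (fst (snd p) + snd (snd p))) < e / 2}"
  have "open ?W"
    by (intro open_Collect_less continuous_on_dist continuous_on_compose2[OF f]
        group_cont continuous_intros) auto
  moreover have "compact (UNIV :: ('g \<times> 'g) set)"
    using compact_Times[OF compact_group_UNIV compact_group_UNIV] by simp
  moreover have "{0} \<times> UNIV \<subseteq> ?W" using assms by auto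
  ultimately obtain V where V: "0 \<in> V" "open V" "V \<times> UNIV \<subseteq> ?W"
    using Elementary_Topology.tube_lemma[of UNIV ?W 0] by blast
  have "osc f v < e" if "v \<in> V" for v
  proof -
    have "osc f v \<le> e / 2"
    proof (rule osc_le)
      fix y z
      have "(v, y, z) \<in> ?W" using V that by blast
      then show "dist (f (y + v + z)) (f (y + z)) \<le> e / 2" by simp
    qed
    with assms show ?thesis by simp
  qed
  with V that show ?thesis by blast
qed

text \<open>A function that is Lipschitz for the length \<open>osc f\<close> inherits continuity
  from \<open>f\<close>. This covers \<open>osc f\<close> itself and all convolutions with a
  continuous factor.\<close>

lemma continuous_if_dist_le_osc:
  fixes g :: "'g \<Rightarrow> 'c::metric_space"
  assumes le: "\<And>x x'. dist (g x) (g x') \<le> C * osc f (x - x')"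
  shows "continuous_on UNIV g"
  unfolding continuous_on_topological
proof clarify
  fix x B assume "open B" "g x \<in> B"
  then obtain e where e: "e > 0" "\<And>y. dist y (g x) < e \<Longrightarrow> y \<in> B"
    by (meson open_dist)
  \<comment> \<open>\<open>C\<close> may be zero or negative, hence the positive
    denominator.\<close>
  have pos: "0 < e / (\<bar>C\<bar> + 1)" using e by simp
  obtain V where V: "open V" "0 \<in> V" "\<And>v. v \<in> V \<Longrightarrow> osc f v < e / (\<bar>C\<bar> + 1)"
    using osc_nbhd[OF pos] by metis
  have "open ((\<lambda>y. y - x) -` V)"
    by (intro open_vimage V group_cont continuous_intros)
  moreover have "x \<in> (\<lambda>y. y - x) -` V" using V by simp
  moreover have "g y \<in> B" if "y \<in> (\<lambda>y. y - x) -` V" for y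
  proof -
    have "dist (g y) (g x) \<le> (\<bar>C\<bar> + 1) * osc f (y - x)"
      using order_trans[OF le mult_right_mono[OF _ osc_nonneg]] by simp
    also have "\<dots> < e"
      using V(3)[of "y - x"] that by (simp add: field_simps)
    finally show ?thesis by (rule e)
  qed
  ultimately show "\<exists>A. open A \<and> x \<in> A \<and> (\<forall>y\<in>UNIV. y \<in> A \<longrightarrow> g y \<in> B)"
    by blast
qed

lemma osc_continuous: "continuous_on UNIV (osc f)"
proof (rule continuous_if_dist_le_osc[of _ 1])
  fix x x'
  have "osc f x \<le> osc f (x - x') + osc f x'" "osc f x' \<le> osc f (x' - x) + osc f x"
    using osc_add[of "x - x'" x'] osc_add[of "x' - x" x] by simp_all
  moreover have "osc f (x' - x) = osc f (x - x')"
    using osc_uminus[of "x - x'"] by simp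
  ultimately show "dist (osc f x) (osc f x') \<le> 1 * osc f (x - x')"
    by (simp add: dist_real_def)
qed

end

section \<open>Haar measure and discretization by simple functions\<close>

lemma space_haar [simp]: "space \<mu> = UNIV"
  and sets_haar [simp, measurable_cong]: "sets \<mu> = sets borel"
  and emeasure_haar_UNIV: "emeasure \<mu> UNIV = 1"
  and emeasure_ltrans: "A \<in> sets borel \<Longrightarrow> emeasure \<mu> ((+) g ` A) = emeasure \<mu> A"
  and outer_reg: "A \<in> sets borel \<Longrightarrow> emeasure \<mu> A = (INF U \<in> {U. open U \<and> A \<subseteq> U}. emeasure \<mu> U)"
  and inner_reg: "open U \<Longrightarrow> emeasure \<mu> U = (SUP K \<in> {K. compact K \<and> K \<subseteq> U}. emeasure \<mu> K)"
  using haar by (auto simp: haar_prob_def)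

sublocale finite_measure \<mu>
  by standard (simp add: emeasure_haar_UNIV)

lemma measure_UNIV: "measure \<mu> UNIV = 1"
  using emeasure_haar_UNIV by (simp add: measure_def)

lemma measurable_continuous:
  fixes f :: "'g \<Rightarrow> 'b::topological_space"
  shows "continuous_on UNIV f \<Longrightarrow> f \<in> borel_measurable \<mu>"
  using borel_measurable_continuous_onI[of f]
  by (simp cong: measurable_cong_sets)

lemma measurable_compose_continuous:
  fixes f :: "'g \<Rightarrow> 'b::topological_space"
  assumes "f \<in> borel_measurable \<mu>" "continuous_on UNIV (g :: 'g \<Rightarrow> 'g)"
  shows "(\<lambda>x. f (g x)) \<in> borel_measurable \<mu>"
proof -
  have "g \<in> measurable \<mu> \<mu>"
    using measurable_continuous[OF assms(2)] by (simp cong: measurable_cong_sets)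
  from measurable_compose[OF this assms(1)] show ?thesis .
qed

lemma integrable_continuous:
  fixes f :: "'g \<Rightarrow> 'b::{banach, second_countable_topology}"
  assumes "continuous_on UNIV f"
  shows "integrable \<mu> f"
proof -
  obtain B where "\<And>x. norm (f x) \<le> B" using continuous_bounded[OF assms] by metis
  then show ?thesis
    by (intro integrable_const_bound[of _ B]) (auto intro: measurable_continuous assms)
qed

text \<open>Finitely many balls for the length \<open>osc f\<close> cover the group;
  \<open>p\<close> sends each point to the centre of a ball that contains it. These maps are the
  meshes of all Riemann sums below.\<close>

lemma simple_function_discretization:
  fixes f :: "'g \<Rightarrow> 'b::real_normed_vector"
  assumes f: "continuous_on UNIV f" and e: "e > 0"
  obtains p where "simple_function \<mu> p" "\<And>z. osc f (z - p z) \<le> e"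
proof -
  let ?U = "\<lambda>c. {z. osc f (z - c) < e}"
  have op: "open (?U c)" for c
    by (intro open_Collect_less continuous_on_compose2[OF osc_continuous[OF f]]
        group_cont continuous_intros) auto
  have "UNIV \<subseteq> (\<Union>c. ?U c)"
  proof
    fix z
    have "z \<in> ?U z" using e osc_0[OF f] by simp
    then show "z \<in> (\<Union>c. ?U c)" by blast
  qed
  then obtain C where C: "finite C" "UNIV \<subseteq> (\<Union>c\<in>C. ?U c)"
    using compactE_image[OF compact_group_UNIV, of UNIV ?U] op by metis
  \<comment> \<open>Induction over the centres: a new centre takes precedence on its own ball and
    leaves the earlier map elsewhere.\<close>
  have "\<exists>p. simple_function \<mu> p \<and> (\<forall>z\<in>(\<Union>c\<in>C. ?U c). osc f (z - p z) \<le> e)"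
    using C(1)
  proof induct
    case empty
    then show ?case by (auto intro!: exI[of _ "\<lambda>_. 0"])
  next
    case (insert c C)
    then obtain p where p: "simple_function \<mu> p" "\<forall>z\<in>(\<Union>c\<in>C. ?U c). osc f (z - p z) \<le> e"
      by blast
    have "simple_function \<mu> (\<lambda>z. if z \<in> ?U c then c else p z)"
      using op[of c] by (intro simple_function_If_set p) auto
    with p(2) show ?case
      by (intro exI[of _ "\<lambda>z. if z \<in> ?U c then c else p z"]) auto
  qed
  then obtain p where "simple_function \<mu> p" "\<forall>z\<in>(\<Union>c\<in>C. ?U c). osc f (z - p z) \<le> e"
    by (elim exE conjE)
  with C(2) show ?thesis by (intro that[of p]) (meson UNIV_I subsetD)+
qed

lemma simple_function_compose_continuous:
  assumes p: "simple_function \<mu> p" and g: "continuous_on UNIV (g :: 'g \<Rightarrow> 'g)"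
  shows "simple_function \<mu> (\<lambda>z. p (g z))"
proof -
  have "g \<in> measurable \<mu> \<mu>"
    using measurable_continuous[OF g] by (simp cong: measurable_cong_sets)
  from simple_function_comp[OF this p] show ?thesis by (simp add: comp_def)
qed

lemma simple_function_levels:
  assumes "simple_function \<mu> p"
  shows "finite (range p)" "p -` {i} \<in> sets borel"
  using simple_functionD(2)[OF assms, of "{i}"] assms by (auto simp: simple_function_def)

text \<open>As \<open>p\<close> takes finitely many values, \<open>F\<close> can be any function at
  all. Later \<open>F i\<close> is the value of a bilinear form at translates indexed by
  \<open>i\<close>.\<close>

lemma integral_simple_weighted:
  fixes a F :: "_ \<Rightarrow> 'b::{real_normed_field, banach, second_countable_topology}"
  assumes p: "simple_function \<mu> p" and a: "integrable \<mu> a"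
  shows "integrable \<mu> (\<lambda>z. a z * F (p z))"
    and "(\<integral>z. a z * F (p z) \<partial>\<mu>) = (\<Sum>i\<in>range p. (\<integral>z. a z * indicator (p -` {i}) z \<partial>\<mu>) * F i)"
proof -
  have *: "integrable \<mu> (\<lambda>z. a z * indicator (p -` {i}) z)" for i
    using integrable_mult_indicator[OF _ a, of "p -` {i}"] simple_function_levels[OF p]
    by (simp add: scaleR_conv_of_real of_real_indicator mult.commute)
  have eq: "a z * F (p z) = (\<Sum>i\<in>range p. a z * indicator (p -` {i}) z * F i)" for z
  proof -
    have "(\<Sum>i\<in>range p. a z * indicator (p -` {i}) z * F i)
        = (\<Sum>i\<in>range p. if i = p z then a z * F i else 0)"
      by (intro sum.cong) (auto simp: indicator_def)
    then show ?thesis using simple_function_levels(1)[OF p] by simp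
  qed
  show "integrable \<mu> (\<lambda>z. a z * F (p z))"
    unfolding eq using * by (intro Bochner_Integration.integrable_sum integrable_mult_left) auto
  show "(\<integral>z. a z * F (p z) \<partial>\<mu>) = (\<Sum>i\<in>range p. (\<integral>z. a z * indicator (p -` {i}) z \<partial>\<mu>) * F i)"
    unfolding eq using * by (subst Bochner_Integration.integral_sum) auto
qed

text \<open>The level sets of \<open>p\<close> are disjoint, so the total size of the coefficients
  is bounded independently of how fine the mesh is.\<close>

lemma sum_weights_le:
  fixes a :: "_ \<Rightarrow> 'b::{real_normed_field, banach, second_countable_topology}"
  assumes p: "simple_function \<mu> p" and a: "integrable \<mu> a"
  shows "(\<Sum>i\<in>range p. norm (\<integral>z. a z * indicator (p -` {i}) z \<partial>\<mu>)) \<le> (\<integral>z. norm (a z) \<partial>\<mu>)"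
proof -
  have "(\<Sum>i\<in>range p. norm (\<integral>z. a z * indicator (p -` {i}) z \<partial>\<mu>))
      \<le> (\<Sum>i\<in>range p. (\<integral>z. norm (a z) * indicator (p -` {i}) z \<partial>\<mu>) * 1)"
  proof (rule sum_mono)
    fix i
    have norm_ind: "norm (indicator A z :: 'b) = indicator A z" for A and z :: 'g
      by (simp add: indicator_def)
    have "norm (\<integral>z. a z * indicator (p -` {i}) z \<partial>\<mu>) \<le> (\<integral>z. norm (a z * indicator (p -` {i}) z) \<partial>\<mu>)"
      by (rule integral_norm_bound)
    then show "norm (\<integral>z. a z * indicator (p -` {i}) z \<partial>\<mu>) \<le> (\<integral>z. norm (a z) * indicator (p -` {i}) z \<partial>\<mu>) * 1"
      by (simp add: norm_mult norm_ind)
  qed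
  also have "\<dots> = (\<integral>z. norm (a z) * 1 \<partial>\<mu>)"
    using integral_simple_weighted(2)[OF p integrable_norm[OF a], of "\<lambda>_. 1"] by simp
  finally show ?thesis by simp
qed

end

section \<open>Invariance of Haar measure and density of continuous functions\<close>

lemma eq_if_dist_le_mult:
  fixes a b :: "'a::metric_space" and C :: real
  assumes "\<And>e. e > 0 \<Longrightarrow> dist a b \<le> e * C"
  shows "a = b"
proof -
  have "dist a b \<le> 0 + e" if "e > 0" for e
  proof -
    have "dist a b \<le> e / (\<bar>C\<bar> + 1) * C" using that by (intro assms) simp
    also have "\<dots> \<le> e / (\<bar>C\<bar> + 1) * (\<bar>C\<bar> + 1)" using that by (intro mult_left_mono) auto
    finally show ?thesis by simp
  qed
  from field_le_epsilon[OF this] show ?thesis by simp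
qed

lemma cmod_sum_square_le: "(cmod (a + b))\<^sup>2 \<le> 2 * (cmod a)\<^sup>2 + 2 * (cmod b)\<^sup>2"
proof -
  have "(cmod (a + b))\<^sup>2 \<le> (cmod a + cmod b)\<^sup>2"
    by (intro power_mono norm_triangle_ineq) simp
  also have "\<dots> \<le> 2 * (cmod a)\<^sup>2 + 2 * (cmod b)\<^sup>2"
    using zero_le_power2[of "cmod a - cmod b"] unfolding power2_diff power2_sum by linarith
  finally show ?thesis .
qed

context compact_haar
begin

text \<open>Phrased through \<open>distr\<close> so that these maps compose and one rule for
  integrals serves translations, inversion and reflections alike.\<close>

definition haar_preserving :: "('g \<Rightarrow> 'g) \<Rightarrow> bool" where
  "haar_preserving T \<longleftrightarrow> T \<in> measurable \<mu> \<mu> \<and> distr \<mu> \<mu> T = \<mu>"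

lemma haar_preserving_integral:
  fixes f :: "'g \<Rightarrow> 'b::{banach, second_countable_topology}"
  assumes "haar_preserving T" "f \<in> borel_measurable \<mu>"
  shows "(\<integral>x. f (T x) \<partial>\<mu>) = (\<integral>x. f x \<partial>\<mu>)"
  using integral_distr[of T \<mu> \<mu> f] assms by (simp add: haar_preserving_def)

lemma haar_preserving_compose:
  assumes "haar_preserving S" "haar_preserving T"
  shows "haar_preserving (\<lambda>x. S (T x))"
  using distr_distr[of S \<mu> \<mu> T \<mu>] assms measurable_compose[of T \<mu> \<mu> S \<mu>]
  by (simp add: haar_preserving_def comp_def)

lemma measurable_continuous_self:
  "continuous_on UNIV (T :: 'g \<Rightarrow> 'g) \<Longrightarrow> T \<in> measurable \<mu> \<mu>"
  using measurable_continuous[of T] by (simp cong: measurable_cong_sets)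

lemma haar_preserving_left: "haar_preserving ((+) g)"
  unfolding haar_preserving_def
proof
  show m: "(+) g \<in> measurable \<mu> \<mu>"
    by (intro measurable_continuous_self group_cont continuous_intros)
  show "distr \<mu> \<mu> ((+) g) = \<mu>"
  proof (rule measure_eqI)
    fix A assume "A \<in> sets (distr \<mu> \<mu> ((+) g))"
    then have A: "A \<in> sets borel" by simp
    have "(+) g -` A = (+) (- g) ` A"
      by (auto simp: image_iff intro!: bexI[of _ "g + x" for x])
    then show "emeasure (distr \<mu> \<mu> ((+) g)) A = emeasure \<mu> A"
      using m A emeasure_ltrans[OF A, of "- g"] by (simp add: emeasure_distr)
  qed simp
qed

text \<open>A compact Hausdorff space is normal.\<close>

lemma urysohn:
  fixes K U :: "'g set"
  assumes K: "compact K" and U: "open U" "K \<subseteq> U"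
  obtains f :: "'g \<Rightarrow> real" where "continuous_on UNIV f" "\<And>x. 0 \<le> f x" "\<And>x. f x \<le> 1"
    "\<And>x. x \<in> K \<Longrightarrow> f x = 1" "\<And>x. x \<notin> U \<Longrightarrow> f x = 0"
proof -
  have "Hausdorff_space (euclidean :: 'g topology)"
    unfolding Hausdorff_space_def using hausdorff
    by (auto simp: disjnt_def)
  then have "normal_space (euclidean :: 'g topology)"
    using compact_Hausdorff_or_regular_imp_normal_space[of "euclidean :: 'g topology"]
      compact_group_UNIV by (simp add: compact_space_def)
  moreover have "closedin euclidean (- U)" "closedin euclidean K" "disjnt (- U) K"
    using K U by (auto simp: compact_imp_closed disjnt_def)
  ultimately obtain f where f: "continuous_map euclidean (top_of_set {0..1::real}) f"
      "f ` (- U) \<subseteq> {0}" "f ` K \<subseteq> {1}"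
    using Urysohn_lemma[of "euclidean :: 'g topology" "- U" K 0 1] by auto
  then have "continuous_on UNIV f" "\<And>x. f x \<in> {0..1}"
    by (auto simp: continuous_map_in_subtopology)
  with f(2,3) show ?thesis by (intro that[of f]) auto
qed

lemma measure_outer:
  assumes "A \<in> sets borel" "e > 0"
  obtains U where "open U" "A \<subseteq> U" "measure \<mu> U < measure \<mu> A + e"
proof -
  have "(INF U \<in> {U. open U \<and> A \<subseteq> U}. emeasure \<mu> U) < emeasure \<mu> A + ennreal e"
    unfolding outer_reg[OF assms(1), symmetric] using assms(2)
    by (simp add: emeasure_eq_measure ennreal_plus[symmetric] ennreal_less_iff del: ennreal_plus)
  then obtain U where "open U" "A \<subseteq> U" "emeasure \<mu> U < emeasure \<mu> A + ennreal e"
    by (auto simp: INF_less_iff)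
  with assms(2) show ?thesis
    by (intro that[of U]) (auto simp: emeasure_eq_measure ennreal_plus[symmetric] ennreal_less_iff simp del: ennreal_plus)
qed

lemma measure_inner:
  assumes "open U" "e > 0"
  obtains K where "compact K" "K \<subseteq> U" "measure \<mu> U < measure \<mu> K + e"
\<comment> \<open>\<open>ennreal\<close> truncates negative reals to \<open>0\<close>, so the
  comparison with the supremum is made only when \<open>measure \<mu> U - e\<close> is nonnegative;
  otherwise the empty set serves.\<close>
proof (cases "measure \<mu> U < e")
  case True
  then show ?thesis using that[of "{}"] by simp
next
  case False
  then have "ennreal (measure \<mu> U - e) < (SUP K \<in> {K. compact K \<and> K \<subseteq> U}. emeasure \<mu> K)"
    unfolding inner_reg[OF assms(1), symmetric] using assms(2)
    by (simp add: emeasure_eq_measure ennreal_less_iff)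
  then obtain K where "compact K" "K \<subseteq> U" "ennreal (measure \<mu> U - e) < emeasure \<mu> K"
    by (auto simp: less_SUP_iff)
  with False show ?thesis
    by (intro that[of K]) (auto simp: emeasure_eq_measure ennreal_less_iff)
qed

text \<open>By left invariance the integral of \<open>f (- y + x)\<close> over \<open>y\<close> is
  the same constant for every \<open>x\<close>, namely the left-hand side. Averaging it over
  \<open>x\<close> and integrating in the other order gives the right-hand side. The exchange is
  made on finite sums: the outer variable \<open>y\<close> is discretized with uniform error
  \<open>e\<close>.\<close>

lemma integral_uminus_continuous:
  fixes f :: "'g \<Rightarrow> real"
  assumes f: "continuous_on UNIV f"
  shows "(\<integral>x. f (- x) \<partial>\<mu>) = (\<integral>x. f x \<partial>\<mu>)"
proof (rule eq_if_dist_le_mult[where C = 1])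
  fix e :: real assume e: "e > 0"
  obtain p where p: "simple_function \<mu> p" "\<And>z. osc f (z - p z) \<le> e"
    using simple_function_discretization[OF f e] by metis
  define c where "c = (\<integral>x. f (- x) \<partial>\<mu>)"
  define m where "m i = (\<integral>z. indicat_real (p -` {i}) z \<partial>\<mu>)" for i
  have cont: "continuous_on UNIV (\<lambda>y. f (k y))" if "continuous_on UNIV k" for k :: "'g \<Rightarrow> 'g"
    using continuous_on_compose2[OF f that] by simp
  \<comment> \<open>Substitute \<open>- x + y\<close> for \<open>y\<close>.\<close>
  have c: "c = (\<integral>y. f (- y + x) \<partial>\<mu>)" for x
    using haar_preserving_integral[OF haar_preserving_left[of "- x"], of "\<lambda>y. f (- y)"]
    by (simp add: c_def minus_add measurable_continuous cont group_cont continuous_intros)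
  have w: "integrable \<mu> (\<lambda>y. f (- p y + x))"
      "(\<integral>y. f (- p y + x) \<partial>\<mu>) = (\<Sum>i\<in>range p. m i * f (- i + x))" for x
    using integral_simple_weighted[OF p(1), of "\<lambda>_. 1" "\<lambda>i. f (- i + x)"]
    by (simp_all add: m_def)
  have close: "dist c (\<Sum>i\<in>range p. m i * f (- i + x)) \<le> e" for x
  proof -
    have i: "integrable \<mu> (\<lambda>y. f (- y + x))"
      by (intro integrable_continuous cont group_cont continuous_intros)
    have "dist c (\<Sum>i\<in>range p. m i * f (- i + x)) = \<bar>\<integral>y. f (- y + x) - f (- p y + x) \<partial>\<mu>\<bar>"
      unfolding c[of x] w(2)[symmetric] dist_real_def
      by (subst Bochner_Integration.integral_diff[OF i w(1)]) simp
    also have "\<dots> \<le> (\<integral>y. \<bar>f (- y + x) - f (- p y + x)\<bar> \<partial>\<mu>)"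
      by (rule integral_abs_bound)
    also have "\<dots> \<le> (\<integral>y. e \<partial>\<mu>)"
    proof (rule integral_mono)
      fix y
      have "\<bar>f (- y + x) - f (- p y + x)\<bar> \<le> osc f (- y - - p y)"
        using dist_le_osc_diff[OF f, of 0 "- y" x "- p y"] by (simp add: dist_real_def)
      also have "\<dots> = osc f (y - p y)"
        using osc_flip[OF f, of y "p y"] by simp
      finally show "\<bar>f (- y + x) - f (- p y + x)\<bar> \<le> e" using p(2)[of y] by simp
    qed (use i w(1) in auto)
    finally show ?thesis by (simp add: measure_UNIV)
  qed
  have sum_m: "(\<Sum>i\<in>range p. m i) = 1"
    using integral_simple_weighted(2)[OF p(1), of "\<lambda>_. 1::real" "\<lambda>_. 1"] measure_UNIV
    by (simp add: m_def)
  have ci: "integrable \<mu> (\<lambda>x. m i * f (- i + x))" for i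
    by (intro integrable_continuous cont group_cont continuous_intros)
  \<comment> \<open>This is the exchange of the two integrals; each translate of \<open>f\<close>
    then integrates to the same value.\<close>
  have "(\<integral>x. (\<Sum>i\<in>range p. m i * f (- i + x)) \<partial>\<mu>) = (\<Sum>i\<in>range p. m i * (\<integral>x. f (- i + x) \<partial>\<mu>))"
    using ci by (subst Bochner_Integration.integral_sum) auto
  also have "\<dots> = (\<Sum>i\<in>range p. m i) * (\<integral>x. f x \<partial>\<mu>)"
    using haar_preserving_integral[OF haar_preserving_left, of f] f
    by (simp add: measurable_continuous sum_distrib_right)
  finally have I: "(\<integral>x. (\<Sum>i\<in>range p. m i * f (- i + x)) \<partial>\<mu>) = (\<integral>x. f x \<partial>\<mu>)"
    by (simp add: sum_m)
  have ints: "integrable \<mu> (\<lambda>x. c - (\<Sum>i\<in>range p. m i * f (- i + x)))"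
    using ci by auto
  have "\<bar>c - (\<integral>x. f x \<partial>\<mu>)\<bar> = \<bar>\<integral>x. c - (\<Sum>i\<in>range p. m i * f (- i + x)) \<partial>\<mu>\<bar>"
    using ci by (subst Bochner_Integration.integral_diff) (auto simp: I measure_UNIV)
  also have "\<dots> \<le> (\<integral>x. \<bar>c - (\<Sum>i\<in>range p. m i * f (- i + x))\<bar> \<partial>\<mu>)"
    by (rule integral_abs_bound)
  also have "\<dots> \<le> (\<integral>x. e \<partial>\<mu>)"
    using close ints by (intro integral_mono) (auto simp: dist_real_def)
  finally show "dist (\<integral>x. f (- x) \<partial>\<mu>) (\<integral>x. f x \<partial>\<mu>) \<le> e * 1"
    by (simp add: dist_real_def c_def measure_UNIV)
qed

text \<open>Inner regularity and Urysohn functions carry the identity for continuous functions over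
  to open sets, and these form an intersection-stable generator of the Borel sets.\<close>

lemma haar_preserving_uminus: "haar_preserving uminus"
  unfolding haar_preserving_def
proof
  show m: "uminus \<in> measurable \<mu> \<mu>"
    by (intro measurable_continuous_self group_cont continuous_intros)
  have cu: "continuous_on UNIV (uminus :: 'g \<Rightarrow> 'g)" by (intro group_cont continuous_intros)
  have op: "open (uminus -` U)" if "open U" for U :: "'g set"
    using open_vimage[OF that cu] .
  have le: "measure \<mu> U \<le> measure \<mu> (uminus -` U)" if U: "open U" for U
  proof (rule field_le_epsilon)
    fix e :: real assume "e > 0"
    then obtain K where K: "compact K" "K \<subseteq> U" "measure \<mu> U < measure \<mu> K + e"
      using measure_inner[OF U] by metis
    then obtain f :: "'g \<Rightarrow> real" where f: "continuous_on UNIV f" "\<And>x. 0 \<le> f x" "\<And>x. f x \<le> 1"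
      "\<And>x. x \<in> K \<Longrightarrow> f x = 1" "\<And>x. x \<notin> U \<Longrightarrow> f x = 0" using urysohn[OF K(1) U K(2)] by metis
    have b: "K \<in> sets borel" "uminus -` U \<in> sets borel"
      using K(1) op[OF U] by (auto intro: borel_closed compact_imp_closed)
    have fm: "continuous_on UNIV (\<lambda>x. f (- x))"
      using continuous_on_compose2[OF f(1) cu] by simp
    have bi: "integrable \<mu> (indicat_real K)" "integrable \<mu> (indicat_real (uminus -` U))"
      using b by (auto intro!: integrable_real_indicator simp: emeasure_eq_measure)
    have "measure \<mu> K = (\<integral>x. indicat_real K x \<partial>\<mu>)" by simp
    also have "\<dots> \<le> (\<integral>x. f x \<partial>\<mu>)"
      using f by (intro integral_mono[OF bi(1) integrable_continuous[OF f(1)]]) (auto simp: indicator_def)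
    also have "\<dots> = (\<integral>x. f (- x) \<partial>\<mu>)" using integral_uminus_continuous[OF f(1)] by simp
    also have "\<dots> \<le> (\<integral>x. indicat_real (uminus -` U) x \<partial>\<mu>)"
      using f by (intro integral_mono[OF integrable_continuous[OF fm] bi(2)]) (auto simp: indicator_def)
    finally show "measure \<mu> U \<le> measure \<mu> (uminus -` U) + e" using K(3) by simp
  qed
  \<comment> \<open>One inequality for all open sets suffices, since it may be applied to the
    inverted set as well.\<close>
  have eq: "emeasure \<mu> (uminus -` U) = emeasure \<mu> U" if U: "open U" for U
    using le[OF U] le[OF op[OF U]] by (simp add: emeasure_eq_measure vimage_def)
  show "distr \<mu> \<mu> uminus = \<mu>"
  proof (rule measure_eqI_generator_eq[where E = "{S. open S}" and \<Omega> = UNIV and A = "\<lambda>_. UNIV"])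
    show "Int_stable {S :: 'g set. open S}" by (auto intro!: Int_stableI)
    show "sets (distr \<mu> \<mu> uminus) = sigma_sets UNIV {S. open S}" "sets \<mu> = sigma_sets UNIV {S. open S}"
      by (simp_all add: borel_def)
    show "emeasure (distr \<mu> \<mu> uminus) X = emeasure \<mu> X" if "X \<in> {S. open S}" for X
      using that m eq by (simp add: emeasure_distr)
    show "emeasure (distr \<mu> \<mu> uminus) UNIV \<noteq> \<infinity>"
      using m by (simp add: emeasure_distr)
  qed auto
qed

text \<open>\<open>x + g\<close> is the inverse of \<open>- g + - x\<close>.\<close>

lemma haar_preserving_right: "haar_preserving (\<lambda>x. x + g)"
  using haar_preserving_compose[OF haar_preserving_uminus
      haar_preserving_compose[OF haar_preserving_left[of "- g"] haar_preserving_uminus]]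
  by (simp add: minus_add)

lemma haar_preserving_reflect: "haar_preserving (\<lambda>x. g - x)"
  using haar_preserving_compose[OF haar_preserving_left[of g] haar_preserving_uminus]
  by simp

section \<open>Square-integrable functions and approximation by continuous ones\<close>

lemma L2_continuous: "continuous_on UNIV f \<Longrightarrow> f \<in> L2 \<mu>"
  by (auto simp: L2_def intro!: measurable_continuous integrable_continuous continuous_intros)

lemma L2_integrable:
  assumes "f \<in> L2 \<mu>" shows "integrable \<mu> f"
proof -
  \<comment> \<open>Expand the square of \<open>cmod (f x) - 1\<close>. As the measure is finite,
    the majorant is integrable.\<close>
  have sq: "cmod (f x) \<le> 1 + (cmod (f x))\<^sup>2" for x
    using zero_le_power2[of "cmod (f x) - 1"] norm_ge_zero[of "f x"] unfolding power2_diff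
    unfolding power_one mult_1_right by linarith
  have le: "AE x in \<mu>. cmod (f x) \<le> norm (1 + (cmod (f x))\<^sup>2)"
    unfolding real_norm_def using order_trans[OF sq abs_ge_self] by (rule AE_I2)
  have "integrable \<mu> (\<lambda>x. 1 + (cmod (f x))\<^sup>2)"
    using assms by (simp add: L2_def)
  then show ?thesis
  proof (rule Bochner_Integration.integrable_bound)
    show "f \<in> borel_measurable \<mu>" using assms by (simp add: L2_def)
  qed (rule le)
qed

lemma L2_lincomb:
  assumes f: "f \<in> L2 \<mu>" and g: "g \<in> L2 \<mu>"
  shows "(\<lambda>x. c * f x + g x) \<in> L2 \<mu>"
proof -
  have m: "(\<lambda>x. c * f x + g x) \<in> borel_measurable \<mu>"
    using f g by (auto simp: L2_def)
  moreover have "integrable \<mu> (\<lambda>x. (cmod (c * f x + g x))\<^sup>2)"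
  proof (rule Bochner_Integration.integrable_bound)
    show "integrable \<mu> (\<lambda>x. 2 * ((cmod c)\<^sup>2 * (cmod (f x))\<^sup>2) + 2 * (cmod (g x))\<^sup>2)"
      using f g by (auto simp: L2_def)
    show "AE x in \<mu>. norm ((cmod (c * f x + g x))\<^sup>2) \<le> norm (2 * ((cmod c)\<^sup>2 * (cmod (f x))\<^sup>2) + 2 * (cmod (g x))\<^sup>2)"
      using cmod_sum_square_le[of "c * f x" "g x" for x]
      by (intro AE_I2) (simp add: norm_mult power_mult_distrib)
    show "(\<lambda>x. (cmod (c * f x + g x))\<^sup>2) \<in> borel_measurable \<mu>"
      using m by measurable
  qed
  ultimately show ?thesis by (simp add: L2_def)
qed

lemma L2_zero: "(\<lambda>_. 0) \<in> L2 \<mu>" by (simp add: L2_def)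

lemma L2_scale: "f \<in> L2 \<mu> \<Longrightarrow> (\<lambda>x. c * f x) \<in> L2 \<mu>"
  using L2_lincomb[OF _ L2_zero, of f c] by simp

lemma L2_diff: "f \<in> L2 \<mu> \<Longrightarrow> g \<in> L2 \<mu> \<Longrightarrow> (\<lambda>x. f x - g x) \<in> L2 \<mu>"
  using L2_lincomb[of g f "- 1"] by simp

lemma L2_add: "f \<in> L2 \<mu> \<Longrightarrow> g \<in> L2 \<mu> \<Longrightarrow> (\<lambda>x. f x + g x) \<in> L2 \<mu>"
  using L2_lincomb[of f g 1] by simp

lemma integral_sum_square_le:
  assumes "f \<in> L2 \<mu>" "g \<in> L2 \<mu>"
  shows "(\<integral>x. (cmod (f x + g x))\<^sup>2 \<partial>\<mu>) \<le> 2 * (\<integral>x. (cmod (f x))\<^sup>2 \<partial>\<mu>) + 2 * (\<integral>x. (cmod (g x))\<^sup>2 \<partial>\<mu>)"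
proof -
  have "(\<integral>x. (cmod (f x + g x))\<^sup>2 \<partial>\<mu>) \<le> (\<integral>x. 2 * (cmod (f x))\<^sup>2 + 2 * (cmod (g x))\<^sup>2 \<partial>\<mu>)"
    using L2_add[OF assms] assms by (intro integral_mono cmod_sum_square_le) (auto simp: L2_def)
  then show ?thesis using assms by (simp add: L2_def)
qed

text \<open>Kept in terms of squared norms: the inequality \<open>cmod_sum_square_le\<close>, with
  its factors 2, then does the work of the triangle inequality.\<close>

definition L2_approx :: "('g \<Rightarrow> complex) \<Rightarrow> bool" where
  "L2_approx f \<longleftrightarrow> (\<forall>e>0. \<exists>g. continuous_on UNIV g \<and> (\<integral>x. (cmod (f x - g x))\<^sup>2 \<partial>\<mu>) < e)"

lemma L2_approx_trans:
  assumes f: "f \<in> L2 \<mu>" and ex: "\<And>e. e > 0 \<Longrightarrow> \<exists>s\<in>L2 \<mu>. L2_approx s \<and> (\<integral>x. (cmod (f x - s x))\<^sup>2 \<partial>\<mu>) < e"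
  shows "L2_approx f"
  unfolding L2_approx_def
proof (intro allI impI)
  fix e :: real assume "e > 0"
  \<comment> \<open>Two errors below \<open>e / 4\<close>, each doubled by
    \<open>integral_sum_square_le\<close>, add up to less than \<open>e\<close>.\<close>
  then have e: "e / 4 > 0" by simp
  obtain s where s: "s \<in> L2 \<mu>" "L2_approx s" "(\<integral>x. (cmod (f x - s x))\<^sup>2 \<partial>\<mu>) < e / 4"
    using ex[OF e] by metis
  then obtain g where g: "continuous_on UNIV g" "(\<integral>x. (cmod (s x - g x))\<^sup>2 \<partial>\<mu>) < e / 4"
    using e unfolding L2_approx_def by blast
  have "(\<integral>x. (cmod (f x - g x))\<^sup>2 \<partial>\<mu>) < e"
    using integral_sum_square_le[OF L2_diff[OF f s(1)] L2_diff[OF s(1) L2_continuous[OF g(1)]]] s(3) g(2)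
    by simp
  with g(1) show "\<exists>g. continuous_on UNIV g \<and> (\<integral>x. (cmod (f x - g x))\<^sup>2 \<partial>\<mu>) < e" by blast
qed

lemma L2_approx_lincomb:
  assumes f: "f \<in> L2 \<mu>" "L2_approx f" and g: "g \<in> L2 \<mu>" "L2_approx g"
  shows "L2_approx (\<lambda>x. c * f x + g x)"
  unfolding L2_approx_def
proof (intro allI impI)
  fix e :: real assume e: "e > 0"
  then have "e / (4 * ((cmod c)\<^sup>2 + 1)) > 0" by (auto intro!: divide_pos_pos add_nonneg_pos)
  then obtain f' where f': "continuous_on UNIV f'" "(\<integral>x. (cmod (f x - f' x))\<^sup>2 \<partial>\<mu>) < e / (4 * ((cmod c)\<^sup>2 + 1))"
    using f(2) unfolding L2_approx_def by blast
  obtain g' where g': "continuous_on UNIV g'" "(\<integral>x. (cmod (g x - g' x))\<^sup>2 \<partial>\<mu>) < e / 4"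
    using g(2) e unfolding L2_approx_def by (metis divide_pos_pos zero_less_numeral)
  have fd: "(\<lambda>x. f x - f' x) \<in> L2 \<mu>" and gd: "(\<lambda>x. g x - g' x) \<in> L2 \<mu>"
    using f g f' g' by (auto intro: L2_diff L2_continuous)
  have I: "0 \<le> (\<integral>x. (cmod (f x - f' x))\<^sup>2 \<partial>\<mu>)" by simp
  have "(\<integral>x. (cmod (c * (f x - f' x)))\<^sup>2 \<partial>\<mu>) = (cmod c)\<^sup>2 * (\<integral>x. (cmod (f x - f' x))\<^sup>2 \<partial>\<mu>)"
    by (simp add: norm_mult power_mult_distrib)
  also have "\<dots> \<le> ((cmod c)\<^sup>2 + 1) * (\<integral>x. (cmod (f x - f' x))\<^sup>2 \<partial>\<mu>)"
    using I by (intro mult_right_mono) auto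
  also have "\<dots> < ((cmod c)\<^sup>2 + 1) * (e / (4 * ((cmod c)\<^sup>2 + 1)))"
    using f'(2) by (intro mult_strict_left_mono add_nonneg_pos) auto
  also have "\<dots> = e / 4"
    using sum_power2_gt_zero_iff[of "cmod c" 1] by (simp add: field_simps)
  finally have *: "(\<integral>x. (cmod (c * (f x - f' x)))\<^sup>2 \<partial>\<mu>) < e / 4" .
  have "(\<integral>x. (cmod (c * f x + g x - (c * f' x + g' x)))\<^sup>2 \<partial>\<mu>)
      = (\<integral>x. (cmod (c * (f x - f' x) + (g x - g' x)))\<^sup>2 \<partial>\<mu>)"
    by (simp add: algebra_simps)
  also have "\<dots> < e"
    using integral_sum_square_le[OF L2_scale[OF fd, of c] gd] * g'(2) by simp
  finally show "\<exists>h. continuous_on UNIV h \<and> (\<integral>x. (cmod (c * f x + g x - h x))\<^sup>2 \<partial>\<mu>) < e"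
    using f'(1) g'(1) by (intro exI[of _ "\<lambda>x. c * f' x + g' x"]) (auto intro!: continuous_intros)
qed

lemma L2_indicator: "A \<in> sets borel \<Longrightarrow> indicator A \<in> L2 \<mu>"
  by (auto simp: L2_def indicator_def if_distrib power2_eq_square cong: if_cong
      intro!: integrable_const_bound[of _ 1] measurable_If_set)

text \<open>Inner regularity is granted for open sets, so \<open>K\<close> approximates the outer
  set \<open>U\<close> from inside and need not lie in \<open>A\<close>. The Urysohn function
  between \<open>K\<close> and \<open>U\<close> agrees with the indicator of \<open>A\<close> off
  \<open>U - A\<close> and \<open>U - K\<close>, both of which are small.\<close>

lemma L2_approx_indicator:
  assumes A: "A \<in> sets borel"
  shows "L2_approx (indicator A)"
  unfolding L2_approx_def
proof (intro allI impI)
  fix e :: real assume "e > 0"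
  then have e: "e / 2 > 0" by simp
  obtain U where U: "open U" "A \<subseteq> U" "measure \<mu> U < measure \<mu> A + e / 2"
    using measure_outer[OF A e] by metis
  obtain K where K: "compact K" "K \<subseteq> U" "measure \<mu> U < measure \<mu> K + e / 2"
    using measure_inner[OF U(1) e] by metis
  obtain f :: "'g \<Rightarrow> real" where f: "continuous_on UNIV f" "\<And>x. 0 \<le> f x" "\<And>x. f x \<le> 1"
      "\<And>x. x \<in> K \<Longrightarrow> f x = 1" "\<And>x. x \<notin> U \<Longrightarrow> f x = 0" using urysohn[OF K(1) U(1) K(2)] by metis
  have b: "U \<in> sets borel" "K \<in> sets borel"
    using U(1) K(1) by (auto intro: borel_closed compact_imp_closed)
  have cf: "continuous_on UNIV (\<lambda>x. complex_of_real (f x))"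
    using f(1) by (intro continuous_intros)
  have "(\<integral>x. (cmod (indicator A x - complex_of_real (f x)))\<^sup>2 \<partial>\<mu>)
      \<le> (\<integral>x. indicat_real (U - A) x + indicat_real (U - K) x \<partial>\<mu>)"
  proof (rule integral_mono)
    show "integrable \<mu> (\<lambda>x. (cmod (indicator A x - complex_of_real (f x)))\<^sup>2)"
      using L2_diff[OF L2_indicator[OF A] L2_continuous[OF cf]] by (simp add: L2_def)
    show "integrable \<mu> (\<lambda>x. indicat_real (U - A) x + indicat_real (U - K) x)"
      using b A by (intro Bochner_Integration.integrable_add) (auto intro!: integrable_real_indicator simp: emeasure_eq_measure)
    fix x
    have r: "cmod (1 - complex_of_real (f x)) = 1 - f x" "cmod (complex_of_real (f x)) = f x"
      using f(2,3)[of x] norm_of_real[of "1 - f x", where 'a = complex] by simp_all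
    moreover have "(f x)\<^sup>2 \<le> 1" "(1 - f x)\<^sup>2 \<le> 1" using f(2,3)[of x] by (simp_all add: power_le_one)
    ultimately show "(cmod (indicator A x - complex_of_real (f x)))\<^sup>2 \<le> indicat_real (U - A) x + indicat_real (U - K) x"
      using f(2,3)[of x] f(4,5)[of x] U(2) K(2)
      by (cases "x \<in> A"; cases "x \<in> K"; cases "x \<in> U") auto
  qed
  also have "\<dots> = measure \<mu> (U - A) + measure \<mu> (U - K)"
    using b A by (subst Bochner_Integration.integral_add) (auto intro!: integrable_real_indicator simp: emeasure_eq_measure)
  also have "\<dots> < e"
    using b A U K by (simp add: finite_measure_Diff)
  finally show "\<exists>g. continuous_on UNIV g \<and> (\<integral>x. (cmod (indicator A x - g x))\<^sup>2 \<partial>\<mu>) < e"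
    using cf by blast
qed

lemma L2_approx_simple:
  assumes s: "simple_function \<mu> (s :: 'g \<Rightarrow> complex)"
  shows "s \<in> L2 \<mu> \<and> L2_approx s"
proof -
  have "(\<lambda>x. \<Sum>i\<in>I. i * indicator (s -` {i}) x) \<in> L2 \<mu> \<and>
      L2_approx (\<lambda>x. \<Sum>i\<in>I. i * indicator (s -` {i}) x)" if "finite I" for I
    using that
  proof induct
    case empty
    show ?case by (auto simp: L2_zero L2_approx_def intro!: exI[of _ "\<lambda>_. 0"])
  next
    case (insert i I)
    then show ?case
      using L2_lincomb[OF L2_indicator, of "s -` {i}" _ i] L2_approx_lincomb[OF L2_indicator L2_approx_indicator, of "s -` {i}" _ i]
        simple_function_levels(2)[OF s, of i] unfolding sum.insert[OF insert(1,2)] by blast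
  qed
  moreover have "(\<Sum>i\<in>range s. i * indicator (s -` {i}) x) = s x" for x
  proof -
    have "(\<Sum>i\<in>range s. i * indicator (s -` {i}) x) = (\<Sum>i\<in>range s. if i = s x then i else 0)"
      by (intro sum.cong) (auto simp: indicator_def)
    then show ?thesis using simple_function_levels(1)[OF s] by simp
  qed
  ultimately show ?thesis using simple_function_levels(1)[OF s] by (metis (no_types, lifting) ext)
qed

lemma L2_approx:
  assumes f: "f \<in> L2 \<mu>" shows "L2_approx f"
proof (rule L2_approx_trans[OF f])
  fix e :: real assume e: "e > 0"
  have fm: "f \<in> borel_measurable \<mu>" using f by (simp add: L2_def)
  obtain s where s: "\<And>i. simple_function \<mu> (s i)" "\<And>x. (\<lambda>i. s i x) \<longlonglongrightarrow> f x"
      "\<And>i x. cmod (s i x) \<le> 2 * cmod (f x)"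
    using borel_measurable_implies_sequence_metric[OF fm, of 0] by auto
  have "(\<lambda>i. \<integral>x. (cmod (f x - s i x))\<^sup>2 \<partial>\<mu>) \<longlonglongrightarrow> (\<integral>x. 0 \<partial>\<mu>)"
  \<comment> \<open>The approximants satisfy \<open>cmod (s i x) \<le> 2 * cmod (f x)\<close>, so
    the difference is at most three times \<open>cmod (f x)\<close>; its square gives the 9.\<close>
  proof (rule integral_dominated_convergence[where w = "\<lambda>x. 9 * (cmod (f x))\<^sup>2"])
    show "(\<lambda>x. (cmod (f x - s i x))\<^sup>2) \<in> borel_measurable \<mu>" for i
    proof -
      have "(\<lambda>x. f x - s i x) \<in> L2 \<mu>"
        using L2_diff[OF f, of "s i"] L2_approx_simple[OF s(1), of i] by simp
      then show ?thesis unfolding L2_def by (blast intro: borel_measurable_integrable)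
    qed
    show "integrable \<mu> (\<lambda>x. 9 * (cmod (f x))\<^sup>2)" using f by (simp add: L2_def)
    show "AE x in \<mu>. (\<lambda>i. (cmod (f x - s i x))\<^sup>2) \<longlonglongrightarrow> 0"
    proof (rule AE_I2)
      fix x
      have "(\<lambda>i. (cmod (f x - s i x))\<^sup>2) \<longlonglongrightarrow> (cmod (f x - f x))\<^sup>2"
        by (intro tendsto_intros s)
      then show "(\<lambda>i. (cmod (f x - s i x))\<^sup>2) \<longlonglongrightarrow> 0" by simp
    qed
    show "AE x in \<mu>. norm ((cmod (f x - s i x))\<^sup>2) \<le> 9 * (cmod (f x))\<^sup>2" for i
    proof (rule AE_I2)
      fix x
      have "cmod (f x - s i x) \<le> 3 * cmod (f x)"
        using norm_triangle_ineq4[of "f x" "s i x"] s(3)[of i x] by simp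
      from power_mono[OF this, of 2] show "norm ((cmod (f x - s i x))\<^sup>2) \<le> 9 * (cmod (f x))\<^sup>2"
        by (simp add: power_mult_distrib)
    qed
  qed simp
  then have "\<forall>\<^sub>F i in sequentially. (\<integral>x. (cmod (f x - s i x))\<^sup>2 \<partial>\<mu>) < e"
    using e by (intro order_tendstoD(2)[of _ 0]) simp_all
  then obtain i where "(\<integral>x. (cmod (f x - s i x))\<^sup>2 \<partial>\<mu>) < e"
    by (meson eventually_happens trivial_limit_sequentially)
  then show "\<exists>s\<in>L2 \<mu>. L2_approx s \<and> (\<integral>x. (cmod (f x - s x))\<^sup>2 \<partial>\<mu>) < e"
    using L2_approx_simple[OF s(1)[of i]] by blast
qed

section \<open>Convolution with continuous densities\<close>

lemma integrable_continuous_mult: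
  fixes c a :: "'g \<Rightarrow> 'b::{real_normed_field, banach, second_countable_topology}"
  assumes c: "continuous_on UNIV c" and a: "integrable \<mu> a"
  shows "integrable \<mu> (\<lambda>x. c x * a x)"
proof -
  obtain B where B: "\<And>x. norm (c x) \<le> B" using continuous_bounded[OF c] by metis
  show ?thesis
  proof (rule Bochner_Integration.integrable_bound)
    show "integrable \<mu> (\<lambda>x. B * norm (a x))" using a by auto
    show "(\<lambda>x. c x * a x) \<in> borel_measurable \<mu>"
      using measurable_continuous[OF c] a by (intro borel_measurable_times) auto
    show "AE x in \<mu>. norm (c x * a x) \<le> norm (B * norm (a x))"
    proof (rule AE_I2)
      fix x
      have "norm (c x * a x) \<le> B * norm (a x)"
        using B by (simp add: norm_mult mult_right_mono)
      then show "norm (c x * a x) \<le> norm (B * norm (a x))"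
        unfolding real_norm_def by (rule order_trans[OF _ abs_ge_self])
    qed
  qed
qed

lemma dist_integral_le:
  fixes F G a :: "'g \<Rightarrow> 'b::{real_normed_field, banach, second_countable_topology}"
  assumes "integrable \<mu> F" "integrable \<mu> G" "integrable \<mu> a"
    and le: "\<And>w. dist (F w) (G w) \<le> e * norm (a w)"
  shows "dist (\<integral>w. F w \<partial>\<mu>) (\<integral>w. G w \<partial>\<mu>) \<le> e * (\<integral>w. norm (a w) \<partial>\<mu>)"
proof -
  have "dist (\<integral>w. F w \<partial>\<mu>) (\<integral>w. G w \<partial>\<mu>) = norm (\<integral>w. F w - G w \<partial>\<mu>)"
    using assms by (simp add: dist_norm)
  also have "\<dots> \<le> (\<integral>w. norm (F w - G w) \<partial>\<mu>)"
    by (rule integral_norm_bound)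
  also have "\<dots> \<le> (\<integral>w. e * norm (a w) \<partial>\<mu>)"
    using assms by (intro integral_mono) (auto simp: dist_norm)
  finally show ?thesis using assms by simp
qed

lemma continuous_on_shift:
  assumes "continuous_on UNIV (f :: 'g \<Rightarrow> 'b::topological_space)" "continuous_on UNIV (T :: 'g \<Rightarrow> 'g)"
  shows "continuous_on UNIV (\<lambda>x. f (T x))"
  using continuous_on_compose2[OF assms] by simp

text \<open>Substituting \<open>x - y\<close> for \<open>y\<close> moves the variable
  \<open>x\<close> into the first factor. With a continuous first factor this yields continuity in
  \<open>x\<close>, even for \<open>a\<close> merely integrable.\<close>

lemma conv_reflect:
  assumes c: "c \<in> borel_measurable \<mu>" and a: "a \<in> borel_measurable \<mu>"
  shows "conv \<mu> c a x = (\<integral>w. c (x - w) * a w \<partial>\<mu>)"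
proof -
  have "(\<lambda>y. a (- y + x)) \<in> borel_measurable \<mu>"
    by (intro measurable_compose_continuous[OF a] group_cont continuous_intros)
  then have "(\<lambda>y. c y * a (- y + x)) \<in> borel_measurable \<mu>"
    using c by measurable
  from haar_preserving_integral[OF haar_preserving_reflect[of x] this] show ?thesis
    by (simp add: conv_def)
qed

lemma continuous_reflected_conv:
  fixes c a :: "'g \<Rightarrow> 'b::{real_normed_field, banach, second_countable_topology}"
  assumes c: "continuous_on UNIV c" and a: "integrable \<mu> a"
  shows "continuous_on UNIV (\<lambda>x. \<integral>w. c (x - w) * a w \<partial>\<mu>)"
proof (rule continuous_if_dist_le_osc[OF c, of _ "\<integral>w. norm (a w) \<partial>\<mu>"])
  fix x x'
  have i: "integrable \<mu> (\<lambda>w. c (y - w) * a w)" for y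
    by (intro integrable_continuous_mult continuous_on_shift[OF c] a group_cont continuous_intros)
  have "dist (c (x - w) * a w) (c (x' - w) * a w) \<le> osc c (x - x') * norm (a w)" for w
    using dist_le_osc_diff[OF c, of 0 x "- w" x']
    by (simp add: dist_norm norm_mult mult_right_mono flip: left_diff_distrib)
  from dist_integral_le[OF i i a this]
  show "dist (\<integral>w. c (x - w) * a w \<partial>\<mu>) (\<integral>w. c (x' - w) * a w \<partial>\<mu>)
      \<le> (\<integral>w. norm (a w) \<partial>\<mu>) * osc c (x - x')" by (simp add: mult.commute)
qed

lemma continuous_conv_left:
  assumes c: "continuous_on UNIV c" and a: "a \<in> L2 \<mu>"
  shows "continuous_on UNIV (conv \<mu> c a)"
proof -
  have "conv \<mu> c a = (\<lambda>x. \<integral>w. c (x - w) * a w \<partial>\<mu>)"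
    using conv_reflect[OF measurable_continuous[OF c]] a by (auto simp: L2_def)
  with continuous_reflected_conv[OF c L2_integrable[OF a]] show ?thesis by simp
qed

lemma integrable_conv_right:
  assumes a: "a \<in> L2 \<mu>" and b: "continuous_on UNIV b"
  shows "integrable \<mu> (\<lambda>y. a y * b (- y + x))"
  by (subst mult.commute) (intro integrable_continuous_mult continuous_on_shift[OF b] L2_integrable[OF a] group_cont continuous_intros)

lemma continuous_conv_right:
  assumes a: "a \<in> L2 \<mu>" and b: "continuous_on UNIV b"
  shows "continuous_on UNIV (conv \<mu> a b)"
proof (rule continuous_if_dist_le_osc[OF b, of _ "\<integral>w. norm (a w) \<partial>\<mu>"])
  fix x x'
  have "dist (a y * b (- y + x)) (a y * b (- y + x')) \<le> osc b (x - x') * norm (a y)" for y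
    using dist_le_osc_diff[OF b, of "- y" x 0 x']
    by (simp add: dist_norm norm_mult mult.commute[of _ "norm (a y)"] mult_left_mono flip: right_diff_distrib)
  from dist_integral_le[OF integrable_conv_right[OF a b] integrable_conv_right[OF a b] L2_integrable[OF a] this]
  show "dist (conv \<mu> a b x) (conv \<mu> a b x') \<le> (\<integral>w. norm (a w) \<partial>\<mu>) * osc b (x - x')"
    by (simp add: conv_def mult.commute)
qed

text \<open>Discretising the convolution makes it a finite combination of translates of \<open>u\<close>; this
  replaces Fubini's theorem, which is unavailable since the Borel \<open>\<sigma>\<close>-algebra of
  \<open>'g \<times> 'g\<close> may exceed the product \<open>\<sigma>\<close>-algebra.\<close>

lemma integral_reflected_conv:
  fixes u F :: "'g \<Rightarrow> real"
  assumes u: "continuous_on UNIV u" and F: "integrable \<mu> F"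
  shows "(\<integral>x. (\<integral>w. u (x - w) * F w \<partial>\<mu>) \<partial>\<mu>) = (\<integral>x. u x \<partial>\<mu>) * (\<integral>x. F x \<partial>\<mu>)"
proof (rule eq_if_dist_le_mult)
  fix e :: real assume e: "e > 0"
  obtain p where p: "simple_function \<mu> p" "\<And>z. osc u (z - p z) \<le> e"
    using simple_function_discretization[OF u e] by metis
  define m where "m i = (\<integral>z. F z * indicat_real (p -` {i}) z \<partial>\<mu>)" for i
  let ?J = "\<lambda>x. \<integral>w. u (x - w) * F w \<partial>\<mu>" and ?S = "\<lambda>x. \<Sum>i\<in>range p. m i * u (x - i)"
  have i: "integrable \<mu> (\<lambda>w. u (x - w) * F w)" for x
    by (intro integrable_continuous_mult continuous_on_shift[OF u] F group_cont continuous_intros)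
  have w: "integrable \<mu> (\<lambda>w. F w * u (x - p w))" "(\<integral>w. F w * u (x - p w) \<partial>\<mu>) = ?S x" for x
    using integral_simple_weighted[OF p(1) F, of "\<lambda>i. u (x - i)"] by (simp_all add: m_def)
  have close: "dist (?J x) (?S x) \<le> e * (\<integral>w. norm (F w) \<partial>\<mu>)" for x
    unfolding w(2)[symmetric]
  proof (rule dist_integral_le[OF i w(1) F])
    fix w
    have "dist (u (x - w)) (u (x - p w)) \<le> osc u (- w - - p w)"
      using dist_le_osc_diff[OF u, of x "- w" 0 "- p w"] by simp
    also have "\<dots> = osc u (w - p w)"
      using osc_flip[OF u, of w "p w"] by simp
    also note p(2)[of w]
    finally show "dist (u (x - w) * F w) (F w * u (x - p w)) \<le> e * norm (F w)"
      by (simp add: dist_norm mult.commute[of "F w"] abs_mult mult_right_mono flip: left_diff_distrib)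
  qed
  have Si: "integrable \<mu> (\<lambda>x. m i * u (x - i))" for i
    by (intro integrable_continuous continuous_intros continuous_on_shift[OF u] group_cont)
  have "(\<integral>x. ?S x \<partial>\<mu>) = (\<Sum>i\<in>range p. m i * (\<integral>x. u (x + - i) \<partial>\<mu>))"
    using Si by (subst Bochner_Integration.integral_sum) auto
  also have "\<dots> = (\<Sum>i\<in>range p. m i * 1) * (\<integral>x. u x \<partial>\<mu>)"
    unfolding haar_preserving_integral[OF haar_preserving_right measurable_continuous[OF u]]
    by (simp add: sum_distrib_right)
  also have "(\<Sum>i\<in>range p. m i * 1) = (\<integral>x. F x \<partial>\<mu>)"
    using integral_simple_weighted(2)[OF p(1) F, of "\<lambda>_. 1"] by (simp add: m_def)
  finally have S: "(\<integral>x. ?S x \<partial>\<mu>) = (\<integral>x. u x \<partial>\<mu>) * (\<integral>x. F x \<partial>\<mu>)" by simp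
  have "dist (\<integral>x. ?J x \<partial>\<mu>) (\<integral>x. ?S x \<partial>\<mu>) \<le> (e * (\<integral>w. norm (F w) \<partial>\<mu>)) * (\<integral>x. norm (1::real) \<partial>\<mu>)"
    using close by (intro dist_integral_le integrable_continuous[OF continuous_reflected_conv[OF u F]]
        Bochner_Integration.integrable_sum Si) auto
  then show "dist (\<integral>x. ?J x \<partial>\<mu>) ((\<integral>x. u x \<partial>\<mu>) * (\<integral>x. F x \<partial>\<mu>)) \<le> e * (\<integral>w. norm (F w) \<partial>\<mu>)"
    unfolding S by (simp add: measure_UNIV)
qed

context
  fixes u :: "'g \<Rightarrow> real"
  assumes u: "continuous_on UNIV u" and u_nonneg: "\<And>x. 0 \<le> u x" and u_int: "(\<integral>x. u x \<partial>\<mu>) = 1"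
begin

lemma continuous_complex_density: "continuous_on UNIV (\<lambda>x. complex_of_real (u x))"
  by (intro continuous_intros u)

text \<open>Jensen's inequality for the probability density \<open>u (x - w)\<close> in
  \<open>w\<close> bounds the square pointwise by an average of squares; integrating over
  \<open>x\<close> removes the average because \<open>u\<close> has integral 1.\<close>

lemma conv_density_contractive:
  assumes f: "f \<in> L2 \<mu>"
  shows "(\<integral>x. (cmod (conv \<mu> (\<lambda>x. complex_of_real (u x)) f x))\<^sup>2 \<partial>\<mu>) \<le> (\<integral>x. (cmod (f x))\<^sup>2 \<partial>\<mu>)"
proof -
  have fi: "integrable \<mu> (\<lambda>x. cmod (f x))" "integrable \<mu> (\<lambda>x. (cmod (f x))\<^sup>2)" "f \<in> borel_measurable \<mu>"
    using L2_integrable[OF f] f by (auto simp: L2_def)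
  have ux: "continuous_on UNIV (\<lambda>w. u (x - w))" for x
    by (intro continuous_on_shift[OF u] group_cont continuous_intros)
  have u1: "(\<integral>w. u (x - w) \<partial>\<mu>) = 1" for x
    using haar_preserving_integral[OF haar_preserving_reflect measurable_continuous[OF u]] u_int by simp
  have le: "(cmod (conv \<mu> (\<lambda>x. complex_of_real (u x)) f x))\<^sup>2 \<le> (\<integral>w. u (x - w) * (cmod (f w))\<^sup>2 \<partial>\<mu>)" for x
  proof -
    define c where "c = (\<integral>w. u (x - w) * cmod (f w) \<partial>\<mu>)"
    have i: "integrable \<mu> (\<lambda>w. u (x - w))" "integrable \<mu> (\<lambda>w. u (x - w) * cmod (f w))"
        "integrable \<mu> (\<lambda>w. u (x - w) * (cmod (f w))\<^sup>2)"
      by (intro integrable_continuous integrable_continuous_mult ux fi)+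
    have "cmod (conv \<mu> (\<lambda>x. complex_of_real (u x)) f x) \<le> (\<integral>w. cmod (complex_of_real (u (x - w)) * f w) \<partial>\<mu>)"
      unfolding conv_reflect[OF measurable_continuous[OF continuous_complex_density] fi(3)] by (rule integral_norm_bound)
    also have "\<dots> = c"
      using u_nonneg by (simp add: c_def norm_mult)
    finally have "(cmod (conv \<mu> (\<lambda>x. complex_of_real (u x)) f x))\<^sup>2 \<le> c\<^sup>2"
      by (intro power_mono) simp_all
    also have "c\<^sup>2 \<le> (\<integral>w. u (x - w) * (cmod (f w))\<^sup>2 \<partial>\<mu>)"
    proof -
      \<comment> \<open>The variance about the mean \<open>c\<close> is nonnegative.\<close>
      have "0 \<le> (\<integral>w. u (x - w) * (cmod (f w) - c)\<^sup>2 \<partial>\<mu>)"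
        by (intro Bochner_Integration.integral_nonneg mult_nonneg_nonneg u_nonneg) simp
      also have "\<dots> = (\<integral>w. u (x - w) * (cmod (f w))\<^sup>2 - 2 * c * (u (x - w) * cmod (f w)) + c\<^sup>2 * u (x - w) \<partial>\<mu>)"
        by (simp add: power2_diff algebra_simps)
      also have "\<dots> = (\<integral>w. u (x - w) * (cmod (f w))\<^sup>2 \<partial>\<mu>) - 2 * c * c + c\<^sup>2 * 1"
        using i by (simp add: c_def u1)
      finally show ?thesis by (simp add: power2_eq_square)
    qed
    finally show ?thesis .
  qed
  have "(\<integral>x. (cmod (conv \<mu> (\<lambda>x. complex_of_real (u x)) f x))\<^sup>2 \<partial>\<mu>)
      \<le> (\<integral>x. (\<integral>w. u (x - w) * (cmod (f w))\<^sup>2 \<partial>\<mu>) \<partial>\<mu>)"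
    using L2_continuous[OF continuous_conv_left[OF continuous_complex_density f]]
    by (intro integral_mono le integrable_continuous[OF continuous_reflected_conv[OF u fi(2)]])
      (auto simp: L2_def)
  also have "\<dots> = (\<integral>x. (cmod (f x))\<^sup>2 \<partial>\<mu>)"
    by (simp add: integral_reflected_conv[OF u fi(2)] u_int)
  finally show ?thesis .
qed

lemma conv_density_close:
  assumes g: "continuous_on UNIV g" and supp: "\<And>x. u x \<noteq> 0 \<Longrightarrow> osc g x \<le> e"
  shows "cmod (conv \<mu> (\<lambda>x. complex_of_real (u x)) g x - g x) \<le> e"
proof -
  have i: "integrable \<mu> (\<lambda>y. complex_of_real (u y) * g (- y + x))"
    by (intro integrable_conv_right L2_continuous continuous_complex_density g)
  have j: "integrable \<mu> (\<lambda>y. complex_of_real (u y) * g x)"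
    by (intro integrable_continuous continuous_intros continuous_complex_density u)
  have "dist (complex_of_real (u y) * g (- y + x)) (complex_of_real (u y) * g x) \<le> e * norm (complex_of_real (u y))" for y
  proof (cases "u y = 0")
    case False
    have "dist (g (- y + x)) (g x) \<le> osc g (- y)"
      using dist_le_osc[OF g, of 0 "- y" x] by simp
    also have "\<dots> \<le> e" using supp[OF False] by (simp add: osc_uminus[OF g])
    finally show ?thesis
      using u_nonneg[of y] by (simp add: dist_norm norm_mult mult.commute[of e] mult_left_mono flip: right_diff_distrib)
  qed simp
  from dist_integral_le[OF i j integrable_continuous[OF continuous_complex_density] this]
  show ?thesis
    using u_nonneg u_int by (simp add: conv_def dist_norm)
qed

text \<open>Writing \<open>u\<close> for the density, split \<open>u * a - a\<close> into
  \<open>u * (a - g)\<close>, \<open>u * g - g\<close> and \<open>g - a\<close>. The first is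
  handled by contractivity, the second by uniform continuity of \<open>g\<close> on the support of
  \<open>u\<close>.\<close>

lemma conv_density_l2norm:
  assumes a: "a \<in> L2 \<mu>" and g: "continuous_on UNIV g" and e: "e > 0"
    and ag: "(\<integral>x. (cmod (a x - g x))\<^sup>2 \<partial>\<mu>) < e\<^sup>2 / 12"
    and supp: "\<And>x. u x \<noteq> 0 \<Longrightarrow> osc g x \<le> e / 4"
  shows "l2norm \<mu> (\<lambda>x. conv \<mu> (\<lambda>x. complex_of_real (u x)) a x - a x) < e"
proof -
  let ?u = "\<lambda>x. complex_of_real (u x)"
  let ?A = "\<lambda>x. conv \<mu> ?u (\<lambda>x. a x - g x) x" and ?B = "\<lambda>x. conv \<mu> ?u g x - g x"
    and ?C = "\<lambda>x. - 1 * (a x - g x) + 0"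
  have gL: "g \<in> L2 \<mu>" by (rule L2_continuous[OF g])
  have d: "(\<lambda>x. a x - g x) \<in> L2 \<mu>" by (rule L2_diff[OF a gL])
  have i: "integrable \<mu> (\<lambda>w. ?u (x - w) * f w)" if "f \<in> L2 \<mu>" for f x
    by (intro integrable_continuous_mult continuous_on_shift[OF continuous_complex_density] L2_integrable that group_cont continuous_intros)
  have lin: "?A x = conv \<mu> ?u a x - conv \<mu> ?u g x" for x
    using a gL d by (subst (1 2 3) conv_reflect[OF measurable_continuous[OF continuous_complex_density]])
      (auto simp: right_diff_distrib i L2_def)
  have mem: "?A \<in> L2 \<mu>" "?B \<in> L2 \<mu>" "?C \<in> L2 \<mu>"
    by (intro L2_continuous continuous_conv_left continuous_complex_density d continuous_intros gL g L2_lincomb[OF d L2_zero])+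
  have "(\<integral>x. (cmod (conv \<mu> ?u a x - a x))\<^sup>2 \<partial>\<mu>) = (\<integral>x. (cmod (?A x + ?B x + ?C x))\<^sup>2 \<partial>\<mu>)"
    by (simp add: lin)
  also have "\<dots> \<le> 2 * (2 * (\<integral>x. (cmod (?A x))\<^sup>2 \<partial>\<mu>) + 2 * (\<integral>x. (cmod (?B x))\<^sup>2 \<partial>\<mu>)) + 2 * (\<integral>x. (cmod (?C x))\<^sup>2 \<partial>\<mu>)"
    by (rule order_trans[OF integral_sum_square_le[OF L2_add[OF mem(1,2)] mem(3)]])
      (intro add_right_mono mult_left_mono integral_sum_square_le[OF mem(1,2)], simp)
  also have "(\<integral>x. (cmod (?C x))\<^sup>2 \<partial>\<mu>) = (\<integral>x. (cmod (a x - g x))\<^sup>2 \<partial>\<mu>)"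
    by (simp add: norm_minus_commute)
  \<comment> \<open>The coefficients are 4, 4 and 2, so the sum is below
    \<open>(4 + 2) / 12 + 4 / 16 = 3 / 4\<close> of \<open>e\<^sup>2\<close>.\<close>
  also have "2 * (2 * (\<integral>x. (cmod (?A x))\<^sup>2 \<partial>\<mu>) + 2 * (\<integral>x. (cmod (?B x))\<^sup>2 \<partial>\<mu>)) + 2 * (\<integral>x. (cmod (a x - g x))\<^sup>2 \<partial>\<mu>) < e\<^sup>2"
  proof -
    have "(\<integral>x. (cmod (?B x))\<^sup>2 \<partial>\<mu>) \<le> (\<integral>x. (e / 4)\<^sup>2 \<partial>\<mu>)"
      using mem(2) conv_density_close[OF g supp] by (intro integral_mono power_mono) (auto simp: L2_def)
    then have "(\<integral>x. (cmod (?B x))\<^sup>2 \<partial>\<mu>) \<le> e\<^sup>2 / 16"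
      by (simp add: measure_UNIV power_divide)
    with conv_density_contractive[OF d] ag zero_le_power2[of e] show ?thesis by argo
  qed
  finally have "(\<integral>x. (cmod (conv \<mu> ?u a x - a x))\<^sup>2 \<partial>\<mu>) < e\<^sup>2" .
  then show ?thesis
    unfolding l2norm_def using e by (simp add: real_sqrt_less_iff[of _ "e\<^sup>2", symmetric, simplified])
qed

end

end

section \<open>Finite tensors and approximate commutation\<close>

definition fin_tens :: "(('g \<Rightarrow> complex) \<times> ('g \<Rightarrow> complex)) list \<Rightarrow> 'g tens" where
  "fin_tens ys n = (if n < length ys then ys ! n else (\<lambda>_. 0, \<lambda>_. 0))"

text \<open>Any \<open>\<Psi>\<close> that kills the zero padding may be summed along the list, so
  one rule covers norms, bilinear forms and products.\<close>

lemma fin_tens_sums: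
  fixes \<Psi> :: "('g \<Rightarrow> complex) \<times> ('g \<Rightarrow> complex) \<Rightarrow> 'b::real_normed_vector"
  assumes "\<Psi> (\<lambda>_. 0, \<lambda>_. 0) = 0"
  shows "(\<lambda>n. \<Psi> (fin_tens ys n)) sums (\<Sum>y\<leftarrow>ys. \<Psi> y)"
proof -
  have "(\<lambda>n. \<Psi> (fin_tens ys n)) sums (\<Sum>n<length ys. \<Psi> (fin_tens ys n))"
    by (rule sums_finite) (auto simp: fin_tens_def assms)
  also have "(\<Sum>n<length ys. \<Psi> (fin_tens ys n)) = (\<Sum>y\<leftarrow>ys. \<Psi> y)"
    by (simp add: sum_list_sum_nth fin_tens_def atLeast0LessThan)
  finally show ?thesis .
qed

lemma flip_fin_tens: "flip (fin_tens ys) = fin_tens (map prod.swap ys)"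
  by (auto simp: flip_def fin_tens_def)

lemma l2norm_zero [simp]: "l2norm \<mu> (\<lambda>_. 0) = 0"
  by (simp add: l2norm_def)

lemma conv_zero [simp]: "conv \<mu> (\<lambda>_. 0) g = (\<lambda>_. 0)" "conv \<mu> g (\<lambda>_. 0) = (\<lambda>_. 0)"
  by (auto simp: conv_def)

lemma lmult_fin_tens: "lmult \<mu> a (fin_tens ys) = fin_tens (map (\<lambda>(b, c). (conv \<mu> a b, c)) ys)"
  by (auto simp: lmult_def fin_tens_def split_beta)

lemma rmult_fin_tens: "rmult \<mu> (fin_tens ys) a = fin_tens (map (\<lambda>(b, c). (b, conv \<mu> c a)) ys)"
  by (auto simp: rmult_def fin_tens_def split_beta)

text \<open>The even and the odd positions are summed separately after reindexing. The sign of the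
  second tensor sits inside its first leg, hence \<open>x + y\<close>.\<close>

lemma tens_diff_sums:
  fixes \<Psi> :: "('g \<Rightarrow> complex) \<times> ('g \<Rightarrow> complex) \<Rightarrow> 'b::real_normed_vector"
  assumes *: "(\<lambda>n. \<Psi> (s n)) sums x" "(\<lambda>n. \<Psi> (\<lambda>x. - fst (t n) x, snd (t n))) sums y"
  shows "(\<lambda>n. \<Psi> (tens_diff s t n)) sums (x + y)"
proof -
  let ?E = "\<lambda>n. if even n then \<Psi> (s (n div 2)) else 0"
  let ?O = "\<lambda>n. if even n then 0 else \<Psi> (\<lambda>x. - fst (t (n div 2)) x, snd (t (n div 2)))"
  have "(\<lambda>n. ?E (2 * n)) sums x \<longleftrightarrow> ?E sums x"
    by (rule sums_mono_reindex) (auto simp: strict_mono_def elim!: evenE)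
  moreover have "(\<lambda>n. ?O (2 * n + 1)) sums y \<longleftrightarrow> ?O sums y"
    by (rule sums_mono_reindex) (auto simp: strict_mono_def elim!: oddE)
  ultimately have "(\<lambda>n. ?E n + ?O n) sums (x + y)"
    using * by (intro sums_add) simp_all
  moreover have "(\<lambda>n. \<Psi> (tens_diff s t n)) = (\<lambda>n. ?E n + ?O n)"
    by (auto simp: tens_diff_def)
  ultimately show ?thesis by simp
qed

lemma l2norm_nonneg: "0 \<le> l2norm \<mu> f"
  by (simp add: l2norm_def)

lemma l2norm_scale: "l2norm \<mu> (\<lambda>x. c * f x) = cmod c * l2norm \<mu> f"
  by (simp add: l2norm_def norm_mult power_mult_distrib real_sqrt_mult)

text \<open>An admissible \<open>t\<close> represents itself, so the infimum is over a nonempty set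
  of nonnegative reals.\<close>

lemma proj_norm_nonneg:
  assumes "tens_ok \<mu> t"
  shows "0 \<le> proj_norm \<mu> t"
  unfolding proj_norm_def
proof (rule cInf_greatest)
  have "tens_equiv \<mu> t t" using assms by (simp add: tens_equiv_def)
  then show "{\<Sum>n. l2norm \<mu> (fst (s n)) * l2norm \<mu> (snd (s n)) |s. tens_equiv \<mu> s t} \<noteq> {}" by blast
qed (auto simp: tens_equiv_def tens_ok_def intro!: suminf_nonneg mult_nonneg_nonneg l2norm_nonneg)

context compact_haar
begin

lemma tens_ok_fin_tens:
  assumes "\<And>b c. (b, c) \<in> set ys \<Longrightarrow> b \<in> L2 \<mu> \<and> c \<in> L2 \<mu>"
  shows "tens_ok \<mu> (fin_tens ys)"
proof -
  have "fst (fin_tens ys n) \<in> L2 \<mu> \<and> snd (fin_tens ys n) \<in> L2 \<mu>" for n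
    using assms[of "fst (ys ! n)" "snd (ys ! n)"] by (auto simp: fin_tens_def L2_zero)
  moreover have "summable (\<lambda>n. l2norm \<mu> (fst (fin_tens ys n)) * l2norm \<mu> (snd (fin_tens ys n)))"
    using fin_tens_sums[of "\<lambda>y. l2norm \<mu> (fst y) * l2norm \<mu> (snd y)" ys] by (auto intro: sums_summable)
  ultimately show ?thesis by (simp add: tens_ok_def)
qed

context
  fixes \<phi> assumes \<phi>: "bdd_bilinear \<mu> \<phi>"
begin

lemma bil_lincomb:
  assumes "f \<in> L2 \<mu>" "f' \<in> L2 \<mu>" "g \<in> L2 \<mu>"
  shows "\<phi> (\<lambda>x. c * f x + f' x) g = c * \<phi> f g + \<phi> f' g"
    and "\<phi> g (\<lambda>x. c * f x + f' x) = c * \<phi> g f + \<phi> g f'"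
  using \<phi> assms unfolding bdd_bilinear_def by blast+

lemma bil_zero:
  assumes "g \<in> L2 \<mu>" shows "\<phi> (\<lambda>_. 0) g = 0" "\<phi> g (\<lambda>_. 0) = 0"
  using bil_lincomb[OF assms assms assms, of "- 1"] by simp_all

lemma bil_scale:
  assumes "f \<in> L2 \<mu>" "g \<in> L2 \<mu>"
  shows "\<phi> (\<lambda>x. c * f x) g = c * \<phi> f g" "\<phi> g (\<lambda>x. c * f x) = c * \<phi> g f"
  using bil_lincomb[OF assms(1) L2_zero assms(2), of c] bil_zero[OF assms(2)] by simp_all

lemma bil_diff:
  assumes "f \<in> L2 \<mu>" "f' \<in> L2 \<mu>" "g \<in> L2 \<mu>"
  shows "\<phi> (\<lambda>x. f x - f' x) g = \<phi> f g - \<phi> f' g" "\<phi> g (\<lambda>x. f x - f' x) = \<phi> g f - \<phi> g f'"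
  using bil_lincomb[OF assms(2,1,3), of "- 1"] by simp_all

lemma bil_sum:
  assumes "finite I" "\<And>i. i \<in> I \<Longrightarrow> f i \<in> L2 \<mu>" "g \<in> L2 \<mu>"
  shows "(\<lambda>x. \<Sum>i\<in>I. c i * f i x) \<in> L2 \<mu>"
    and "\<phi> (\<lambda>x. \<Sum>i\<in>I. c i * f i x) g = (\<Sum>i\<in>I. c i * \<phi> (f i) g)"
    and "\<phi> g (\<lambda>x. \<Sum>i\<in>I. c i * f i x) = (\<Sum>i\<in>I. c i * \<phi> g (f i))"
  using assms(1,2)
  by (induct) (auto simp: L2_zero bil_zero bil_lincomb assms(3) intro: L2_lincomb)

end

text \<open>The functional \<open>\<phi> \<mapsto> \<langle>t, \<phi>\<rangle>\<close> on bounded bilinear forms determines the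
  tensor \<open>t\<close>; \<open>tens_rep \<Phi> r\<close> certifies that \<open>\<Phi>\<close> comes from a finite tensor of projective
  norm at most \<open>r\<close>.\<close>

definition tens_rep :: "((('g \<Rightarrow> complex) \<Rightarrow> ('g \<Rightarrow> complex) \<Rightarrow> complex) \<Rightarrow> complex) \<Rightarrow> real \<Rightarrow> bool" where
  "tens_rep \<Phi> r \<longleftrightarrow> (\<exists>ys. (\<forall>(b, c)\<in>set ys. b \<in> L2 \<mu> \<and> c \<in> L2 \<mu>) \<and>
     (\<Sum>(b, c)\<leftarrow>ys. l2norm \<mu> b * l2norm \<mu> c) \<le> r \<and>
     (\<forall>\<phi>. bdd_bilinear \<mu> \<phi> \<longrightarrow> \<Phi> \<phi> = (\<Sum>(b, c)\<leftarrow>ys. \<phi> b c)))"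

lemma tens_repI:
  assumes "\<And>b c. (b, c) \<in> set ys \<Longrightarrow> b \<in> L2 \<mu> \<and> c \<in> L2 \<mu>"
    "(\<Sum>(b, c)\<leftarrow>ys. l2norm \<mu> b * l2norm \<mu> c) \<le> r"
    "\<And>\<phi>. bdd_bilinear \<mu> \<phi> \<Longrightarrow> \<Phi> \<phi> = (\<Sum>(b, c)\<leftarrow>ys. \<phi> b c)"
  shows "tens_rep \<Phi> r"
  unfolding tens_rep_def using assms by (intro exI[of _ ys]) auto

lemma tens_repE:
  assumes "tens_rep \<Phi> r"
  obtains ys where "\<And>b c. (b, c) \<in> set ys \<Longrightarrow> b \<in> L2 \<mu> \<and> c \<in> L2 \<mu>"
    "(\<Sum>(b, c)\<leftarrow>ys. l2norm \<mu> b * l2norm \<mu> c) \<le> r"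
    "\<And>\<phi>. bdd_bilinear \<mu> \<phi> \<Longrightarrow> \<Phi> \<phi> = (\<Sum>(b, c)\<leftarrow>ys. \<phi> b c)"
  using assms unfolding tens_rep_def by blast

lemma tens_rep_cong:
  assumes "tens_rep \<Phi> r" "\<And>\<phi>. bdd_bilinear \<mu> \<phi> \<Longrightarrow> \<Psi> \<phi> = \<Phi> \<phi>" "r \<le> s"
  shows "tens_rep \<Psi> s"
proof -
  from assms(1) obtain ys where "\<And>b c. (b, c) \<in> set ys \<Longrightarrow> b \<in> L2 \<mu> \<and> c \<in> L2 \<mu>"
    "(\<Sum>(b, c)\<leftarrow>ys. l2norm \<mu> b * l2norm \<mu> c) \<le> r"
    "\<And>\<phi>. bdd_bilinear \<mu> \<phi> \<Longrightarrow> \<Phi> \<phi> = (\<Sum>(b, c)\<leftarrow>ys. \<phi> b c)" by (rule tens_repE) blast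
  then show ?thesis using assms(2,3) by (intro tens_repI[of ys]) auto
qed

lemma tens_rep_zero: "tens_rep (\<lambda>_. 0) 0"
  by (rule tens_repI[of "[]"]) auto

lemma tens_rep_add:
  assumes "tens_rep \<Phi> r" "tens_rep \<Psi> s"
  shows "tens_rep (\<lambda>\<phi>. \<Phi> \<phi> + \<Psi> \<phi>) (r + s)"
proof -
  obtain ys where ys: "\<And>b c. (b, c) \<in> set ys \<Longrightarrow> b \<in> L2 \<mu> \<and> c \<in> L2 \<mu>"
    "(\<Sum>(b, c)\<leftarrow>ys. l2norm \<mu> b * l2norm \<mu> c) \<le> r"
    "\<And>\<phi>. bdd_bilinear \<mu> \<phi> \<Longrightarrow> \<Phi> \<phi> = (\<Sum>(b, c)\<leftarrow>ys. \<phi> b c)" by (rule tens_repE[OF assms(1)]) blast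
  obtain zs where zs: "\<And>b c. (b, c) \<in> set zs \<Longrightarrow> b \<in> L2 \<mu> \<and> c \<in> L2 \<mu>"
    "(\<Sum>(b, c)\<leftarrow>zs. l2norm \<mu> b * l2norm \<mu> c) \<le> s"
    "\<And>\<phi>. bdd_bilinear \<mu> \<phi> \<Longrightarrow> \<Psi> \<phi> = (\<Sum>(b, c)\<leftarrow>zs. \<phi> b c)" by (rule tens_repE[OF assms(2)]) blast
  show ?thesis
  proof (rule tens_repI[of "ys @ zs"])
    show "b \<in> L2 \<mu> \<and> c \<in> L2 \<mu>" if "(b, c) \<in> set (ys @ zs)" for b c
      using that ys(1) zs(1) by auto
    show "(\<Sum>(b, c)\<leftarrow>ys @ zs. l2norm \<mu> b * l2norm \<mu> c) \<le> r + s"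
      using ys(2) zs(2) by simp
  qed (simp add: ys(3) zs(3))
qed

lemma tens_rep_scale:
  assumes "tens_rep \<Phi> r"
  shows "tens_rep (\<lambda>\<phi>. k * \<Phi> \<phi>) (cmod k * r)"
proof -
  obtain ys where ys: "\<And>b c. (b, c) \<in> set ys \<Longrightarrow> b \<in> L2 \<mu> \<and> c \<in> L2 \<mu>"
    "(\<Sum>(b, c)\<leftarrow>ys. l2norm \<mu> b * l2norm \<mu> c) \<le> r"
    "\<And>\<phi>. bdd_bilinear \<mu> \<phi> \<Longrightarrow> \<Phi> \<phi> = (\<Sum>(b, c)\<leftarrow>ys. \<phi> b c)" by (rule tens_repE[OF assms]) blast
  let ?zs = "map (\<lambda>(b, c). (\<lambda>x. k * b x, c)) ys"
  show ?thesis
  proof (rule tens_repI[of ?zs])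
    show "b \<in> L2 \<mu> \<and> c \<in> L2 \<mu>" if "(b, c) \<in> set ?zs" for b c
      using that ys(1) by (auto intro: L2_scale)
    have "(\<Sum>(b, c)\<leftarrow>?zs. l2norm \<mu> b * l2norm \<mu> c) = cmod k * (\<Sum>(b, c)\<leftarrow>ys. l2norm \<mu> b * l2norm \<mu> c)"
      by (simp add: sum_list_const_mult[symmetric] comp_def split_beta l2norm_scale mult.assoc)
    then show "(\<Sum>(b, c)\<leftarrow>?zs. l2norm \<mu> b * l2norm \<mu> c) \<le> cmod k * r"
      using ys(2) by (simp add: mult_left_mono)
  next
    fix \<phi> assume \<phi>: "bdd_bilinear \<mu> \<phi>"
    have "(\<Sum>(b, c)\<leftarrow>?zs. \<phi> b c) = (\<Sum>y\<leftarrow>ys. k * \<phi> (fst y) (snd y))"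
      unfolding map_map comp_def split_beta fst_conv snd_conv
      by (intro arg_cong[where f = sum_list] map_cong refl bil_scale[OF \<phi>]) (use ys(1) in force)+
    then show "k * \<Phi> \<phi> = (\<Sum>(b, c)\<leftarrow>?zs. \<phi> b c)"
      by (simp add: ys(3)[OF \<phi>] sum_list_const_mult case_prod_unfold)
  qed
qed

lemma tens_rep_diff:
  assumes "tens_rep \<Phi> r" "tens_rep \<Psi> s"
  shows "tens_rep (\<lambda>\<phi>. \<Phi> \<phi> - \<Psi> \<phi>) (r + s)"
  using tens_rep_add[OF assms(1) tens_rep_scale[OF assms(2), of "- 1"]] by simp

lemma tens_rep_sum:
  assumes "finite I" "\<And>i. i \<in> I \<Longrightarrow> tens_rep (F i) s"
  shows "tens_rep (\<lambda>\<phi>. \<Sum>i\<in>I. k i * F i \<phi>) ((\<Sum>i\<in>I. cmod (k i)) * s)"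
  using assms
proof induct
  case empty
  then show ?case using tens_rep_zero by simp
next
  case (insert i I)
  then show ?case
    using tens_rep_add[OF tens_rep_scale[of "F i" s "k i"]] by (simp add: distrib_right)
qed

lemma l2norm_le_bound:
  assumes "f \<in> L2 \<mu>" "\<And>x. cmod (f x) \<le> B"
  shows "l2norm \<mu> f \<le> B"
proof -
  have B: "0 \<le> B" using order_trans[OF norm_ge_zero assms(2)] .
  have "(\<integral>x. (cmod (f x))\<^sup>2 \<partial>\<mu>) \<le> (\<integral>x. B\<^sup>2 \<partial>\<mu>)"
    using assms by (intro integral_mono power_mono) (auto simp: L2_def)
  then show ?thesis
    unfolding l2norm_def using B by (simp add: measure_UNIV real_le_lsqrt)
qed

lemma tens_rep_elem:
  assumes "b \<in> L2 \<mu>" "c \<in> L2 \<mu>" "\<And>x. cmod (b x) \<le> B" "\<And>x. cmod (c x) \<le> C"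
  shows "tens_rep (\<lambda>\<phi>. \<phi> b c) (B * C)"
proof (rule tens_repI[of "[(b, c)]"])
  have "0 \<le> B" using order_trans[OF norm_ge_zero assms(3)] .
  then show "(\<Sum>(b, c)\<leftarrow>[(b, c)]. l2norm \<mu> b * l2norm \<mu> c) \<le> B * C"
    using assms by (simp add: mult_mono l2norm_le_bound l2norm_nonneg)
qed (use assms in auto)

text \<open>A list representing the same functional is an equivalent tensor, hence a competitor in
  the infimum.\<close>

lemma proj_norm_le:
  assumes t: "tens_ok \<mu> t" and rep: "tens_rep \<Phi> r"
    and eq: "\<And>\<phi>. bdd_bilinear \<mu> \<phi> \<Longrightarrow> (\<Sum>n. \<phi> (fst (t n)) (snd (t n))) = \<Phi> \<phi>"
  shows "proj_norm \<mu> t \<le> r"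
proof -
  obtain ys where ys: "\<And>b c. (b, c) \<in> set ys \<Longrightarrow> b \<in> L2 \<mu> \<and> c \<in> L2 \<mu>"
    "(\<Sum>(b, c)\<leftarrow>ys. l2norm \<mu> b * l2norm \<mu> c) \<le> r"
    "\<And>\<phi>. bdd_bilinear \<mu> \<phi> \<Longrightarrow> \<Phi> \<phi> = (\<Sum>(b, c)\<leftarrow>ys. \<phi> b c)" by (rule tens_repE[OF rep]) blast
  have "tens_equiv \<mu> (fin_tens ys) t"
    unfolding tens_equiv_def
  proof (intro conjI t tens_ok_fin_tens ys(1) allI impI)
    fix \<phi> assume \<phi>: "bdd_bilinear \<mu> \<phi>"
    show "(\<Sum>n. \<phi> (fst (fin_tens ys n)) (snd (fin_tens ys n))) = (\<Sum>n. \<phi> (fst (t n)) (snd (t n)))"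
      using fin_tens_sums[of "\<lambda>y. \<phi> (fst y) (snd y)" ys] bil_zero[OF \<phi> L2_zero]
      by (simp add: eq[OF \<phi>] ys(3)[OF \<phi>] case_prod_unfold sums_iff)
  qed (use ys(1) in auto)
  then have "proj_norm \<mu> t \<le> (\<Sum>n. l2norm \<mu> (fst (fin_tens ys n)) * l2norm \<mu> (snd (fin_tens ys n)))"
    unfolding proj_norm_def
    by (intro cInf_lower bdd_belowI[of _ 0])
      (auto simp: tens_equiv_def tens_ok_def intro!: suminf_nonneg mult_nonneg_nonneg l2norm_nonneg)
  also have "\<dots> = (\<Sum>(b, c)\<leftarrow>ys. l2norm \<mu> b * l2norm \<mu> c)"
    using fin_tens_sums[of "\<lambda>y. l2norm \<mu> (fst y) * l2norm \<mu> (snd y)" ys]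
    by (simp add: case_prod_unfold sums_iff)
  finally show ?thesis using ys(2) by simp
qed

section \<open>Commutators of Riemann sums with elements of \<open>L2\<close>\<close>

text \<open>The complex measure with density \<open>a\<close> pushed forward along \<open>p\<close>,
  evaluated at the point \<open>i\<close>. With \<open>a = 1\<close> it gives the masses of the
  Riemann nodes.\<close>

definition weight :: "('g \<Rightarrow> complex) \<Rightarrow> ('g \<Rightarrow> 'i) \<Rightarrow> 'i \<Rightarrow> complex" where
  "weight a p i = (\<integral>z. a z * indicator (p -` {i}) z \<partial>\<mu>)"

lemma sum_weight:
  fixes F :: "'i \<Rightarrow> complex"
  assumes "simple_function \<mu> p" "integrable \<mu> a"
  shows "(\<Sum>i\<in>range p. weight a p i * F i) = (\<integral>z. a z * F (p z) \<partial>\<mu>)"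
  using integral_simple_weighted(2)[OF assms, of F] by (simp add: weight_def)

lemma sum_weight1:
  fixes F :: "'i \<Rightarrow> complex"
  assumes "simple_function \<mu> p"
  shows "(\<Sum>i\<in>range p. weight (\<lambda>_. 1) p i * F i) = (\<integral>z. F (p z) \<partial>\<mu>)"
  using sum_weight[OF assms, of "\<lambda>_. 1" F] by simp

text \<open>The bound involves \<open>a\<close> and \<open>s\<close> only, not the number of nodes,
  so refining the mesh costs nothing.\<close>

lemma tens_rep_weight:
  assumes p: "simple_function \<mu> p" and a: "integrable \<mu> a" and s: "0 \<le> s"
    and F: "\<And>z. tens_rep (F (p z)) s"
  shows "tens_rep (\<lambda>\<phi>. \<Sum>i\<in>range p. weight a p i * F i \<phi>) ((\<integral>z. cmod (a z) \<partial>\<mu>) * s)"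
proof (rule tens_rep_cong[OF tens_rep_sum[of _ F s] refl])
  show "(\<Sum>i\<in>range p. cmod (weight a p i)) * s \<le> (\<integral>z. cmod (a z) \<partial>\<mu>) * s"
    using sum_weights_le[OF p a] s unfolding weight_def by (rule mult_right_mono)
qed (use simple_function_levels(1)[OF p] F in auto)

lemma tens_rep_weight1:
  assumes "simple_function \<mu> p" "0 \<le> s" "\<And>z. tens_rep (F (p z)) s"
  shows "tens_rep (\<lambda>\<phi>. \<Sum>i\<in>range p. weight (\<lambda>_. 1) p i * F i \<phi>) s"
  using tens_rep_weight[where F = F, OF assms(1) _ assms(2,3), of "\<lambda>_. 1"] by (simp add: measure_UNIV)

text \<open>The point mass at \<open>i\<close> convolved with \<open>h\<close>; left translation by
  \<open>j\<close> therefore acts on the index by \<open>i\<close> to \<open>j + i\<close>.\<close>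

definition ltr :: "('g \<Rightarrow> real) \<Rightarrow> 'g \<Rightarrow> 'g \<Rightarrow> complex" where
  "ltr h i x = complex_of_real (h (- i + x))"

lemma ltr_continuous:
  assumes "continuous_on UNIV h" shows "continuous_on UNIV (ltr h i)"
  unfolding ltr_def by (intro continuous_intros continuous_on_shift[OF assms] group_cont)

lemma ltr_L2: "continuous_on UNIV h \<Longrightarrow> ltr h i \<in> L2 \<mu>"
  by (rule L2_continuous[OF ltr_continuous])

text \<open>The pairing with \<open>\<phi>\<close> of the commutator of \<open>a\<close> with the
  elementary tensor at one node \<open>i\<close>.\<close>

definition commutator ::
    "('g \<Rightarrow> real) \<Rightarrow> ('g \<Rightarrow> complex) \<Rightarrow> 'g \<Rightarrow> (('g \<Rightarrow> complex) \<Rightarrow> ('g \<Rightarrow> complex) \<Rightarrow> complex) \<Rightarrow> complex" where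
  "commutator h a i \<phi> =
     \<phi> (conv \<mu> a (ltr h i)) (ltr h (- i)) - \<phi> (ltr h i) (conv \<mu> (ltr h (- i)) a)"

text \<open>The error of replacing \<open>a\<close> by the combination of point masses with
  coefficients \<open>weight a p j\<close>.\<close>

definition lrem :: "('g \<Rightarrow> real) \<Rightarrow> ('g \<Rightarrow> complex) \<Rightarrow> ('g \<Rightarrow> 'g) \<Rightarrow> 'g \<Rightarrow> 'g \<Rightarrow> complex" where
  "lrem h a p i x = conv \<mu> a (ltr h i) x - (\<Sum>j\<in>range p. weight a p j * ltr h (j + i) x)"

definition rrem :: "('g \<Rightarrow> real) \<Rightarrow> ('g \<Rightarrow> complex) \<Rightarrow> ('g \<Rightarrow> 'g) \<Rightarrow> 'g \<Rightarrow> 'g \<Rightarrow> complex" where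
  "rrem h a p i x = conv \<mu> (ltr h (- i)) a x - (\<Sum>j\<in>range p. weight a p j * ltr h (- i + j) x)"

context
  fixes h :: "'g \<Rightarrow> real" and H :: real
  assumes h: "continuous_on UNIV h" and central: "\<And>x y. h (x + y) = h (y + x)"
    and h_bound: "\<And>x. \<bar>h x\<bar> \<le> H"
begin

lemmas ltr_cont = ltr_continuous[OF h] and ltr_mem = ltr_L2[OF h]

lemma ltr_bound: "cmod (ltr h i x) \<le> H"
  using h_bound by (simp add: ltr_def)

lemma ltr_dist: "cmod (ltr h i x - ltr h k x) \<le> osc h (i - k)"
proof -
  have "cmod (ltr h i x - ltr h k x) = dist (h (- i + x)) (h (- k + x))"
    by (simp add: ltr_def dist_real_def flip: of_real_diff)
  also have "\<dots> \<le> osc h (- i + k)"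
    using dist_le_osc_diff[OF h, of 0 "- i" x "- k"] by simp
  finally show ?thesis by (simp add: osc_flip[OF h])
qed

context
  fixes a :: "'g \<Rightarrow> complex" and p :: "'g \<Rightarrow> 'g" and e :: real
  assumes a: "a \<in> L2 \<mu>" and p: "simple_function \<mu> p" and close: "\<And>z. osc h (z - p z) \<le> e"
begin

lemma rem_L2: "lrem h a p i \<in> L2 \<mu>" "rrem h a p i \<in> L2 \<mu>"
  unfolding lrem_def rrem_def
  by (intro L2_continuous continuous_intros continuous_conv_left continuous_conv_right a ltr_cont)+

lemma lrem_bound: "cmod (lrem h a p i x) \<le> e * (\<integral>w. cmod (a w) \<partial>\<mu>)"
proof -
  have "dist (conv \<mu> a (ltr h i) x) (\<integral>w. a w * ltr h (p w + i) x \<partial>\<mu>) \<le> e * (\<integral>w. cmod (a w) \<partial>\<mu>)"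
    unfolding conv_def
  proof (rule dist_integral_le[OF integrable_conv_right[OF a ltr_cont] _ L2_integrable[OF a]])
    show "integrable \<mu> (\<lambda>w. a w * ltr h (p w + i) x)"
      using integral_simple_weighted(1)[OF p L2_integrable[OF a], of "\<lambda>j. ltr h (j + i) x"] .
    fix w
    have "ltr h i (- w + x) = ltr h (w + i) x"
      by (simp add: ltr_def group_norm del: add_uminus_conv_diff)
    then have "cmod (ltr h i (- w + x) - ltr h (p w + i) x) \<le> osc h (w - p w)"
      using ltr_dist[of "w + i" x "p w + i"] by (simp add: group_norm del: add_uminus_conv_diff)
    also note close[of w]
    finally show "dist (a w * ltr h i (- w + x)) (a w * ltr h (p w + i) x) \<le> e * cmod (a w)"
      by (simp add: dist_norm norm_mult mult.commute[of e] mult_left_mono flip: right_diff_distrib)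
  qed
  then show ?thesis
    by (simp add: lrem_def sum_weight[OF p L2_integrable[OF a]] dist_norm)
qed

lemma rrem_bound: "cmod (rrem h a p i x) \<le> e * (\<integral>w. cmod (a w) \<partial>\<mu>)"
proof -
  have m: "ltr h (- i) \<in> borel_measurable \<mu>" "a \<in> borel_measurable \<mu>"
    using ltr_mem a by (auto simp: L2_def)
  have "dist (conv \<mu> (ltr h (- i)) a x) (\<integral>w. a w * ltr h (- i + p w) x \<partial>\<mu>) \<le> e * (\<integral>w. cmod (a w) \<partial>\<mu>)"
    unfolding conv_reflect[OF m]
  proof (rule dist_integral_le[OF _ _ L2_integrable[OF a]])
    show "integrable \<mu> (\<lambda>w. ltr h (- i) (x - w) * a w)"
      by (intro integrable_continuous_mult continuous_on_shift[OF ltr_cont] L2_integrable a group_cont continuous_intros)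
    show "integrable \<mu> (\<lambda>w. a w * ltr h (- i + p w) x)"
      using integral_simple_weighted(1)[OF p L2_integrable[OF a], of "\<lambda>j. ltr h (- i + j) x"] .
    fix w
    \<comment> \<open>By centrality, a right translate of \<open>ltr h (- i)\<close> is again some
      \<open>ltr h\<close>, with the index multiplied on the right.\<close>
    have "ltr h (- i) (x - w) = ltr h (- i + w) x"
      using central[of "i + x" "- w"] by (simp add: ltr_def group_norm del: add_uminus_conv_diff)
    then have "cmod (ltr h (- i) (x - w) - ltr h (- i + p w) x) \<le> osc h (- i + (w - p w) + i)"
      using ltr_dist[of "- i + w" x "- i + p w"] by (simp add: group_norm del: add_uminus_conv_diff)
    also have "\<dots> = osc h (w - p w)"
      using osc_conj[OF h, of "- i" "w - p w"] by simp
    also note close[of w]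
    finally show "dist (ltr h (- i) (x - w) * a w) (a w * ltr h (- i + p w) x) \<le> e * cmod (a w)"
      by (simp add: dist_norm norm_mult mult.commute[of _ "a w"] mult.commute[of e] mult_left_mono flip: right_diff_distrib)
  qed
  then show ?thesis
    by (simp add: rrem_def sum_weight[OF p L2_integrable[OF a]] dist_norm)
qed

text \<open>The joint distribution of \<open>p z\<close> and \<open>p (j + z)\<close> couples the level sets of \<open>p\<close> with
  their translates by \<open>j\<close>.\<close>

lemma translate_commutator_rep:
  "tens_rep (\<lambda>\<phi>. \<Sum>i\<in>range p. weight (\<lambda>_. 1) p i *
      (\<phi> (ltr h (j + i)) (ltr h (- i)) - \<phi> (ltr h i) (ltr h (- i + j)))) (4 * e * H)"
proof -
  have jc: "continuous_on UNIV ((+) j)" by (intro group_cont continuous_intros)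
  have pj: "simple_function \<mu> (\<lambda>z. p (j + z))"
    by (rule simple_function_compose_continuous[OF p jc])
  let ?q = "\<lambda>z. (p z, p (j + z))"
  have q: "simple_function \<mu> ?q" by (rule simple_function_Pair[OF p pj])
  have e: "0 \<le> e" using order_trans[OF osc_nonneg[OF h] close] .
  have H: "0 \<le> H" using order_trans[OF abs_ge_zero h_bound] .
  let ?F = "\<lambda>(i, k) \<phi>. \<phi> (ltr h (j + i)) (ltr h (- i)) - \<phi> (ltr h k) (ltr h (- k + j))"
  have F: "tens_rep (?F (?q z)) (4 * e * H)" for z
  proof -
    define i k where ik: "i = p z" "k = p (j + z)"
    \<comment> \<open>\<open>i\<close> lies within \<open>e\<close> of \<open>z\<close> and
      \<open>k\<close> within \<open>e\<close> of \<open>j + z\<close>; left translation by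
      \<open>j\<close> turns the first difference into a conjugate, of the same length.\<close>
    have "osc h (j + i - k) \<le> osc h (j + (i - z) - j) + osc h (j + z - k)"
      using osc_add[OF h, of "j + (i - z) - j" "j + z - k"] by (simp add: group_norm del: add_uminus_conv_diff)
    also have "osc h (j + (i - z) - j) = osc h (z - i)"
      using osc_uminus[OF h, of "z - i"] by (simp add: osc_conj[OF h])
    finally have d: "osc h (j + i - k) \<le> 2 * e"
      using close[of z] close[of "j + z"] by (simp add: ik)
    have d1: "cmod (ltr h (j + i) x - ltr h k x) \<le> 2 * e" for x
      using order_trans[OF ltr_dist d] .
    have "osc h (- i - (- k + j)) = osc h (j + i - k)"
      using osc_flip[OF h, of "j + i" k] by (simp add: group_norm del: add_uminus_conv_diff)
    with d have d2: "cmod (ltr h (- i) x - ltr h (- k + j) x) \<le> 2 * e" for x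
      using ltr_dist[of "- i" x "- k + j"] by simp
    \<comment> \<open>Telescoping changes one leg at a time: each difference is at most
      \<open>2 * e\<close>, the other leg at most \<open>H\<close>.\<close>
    have "tens_rep (\<lambda>\<phi>. \<phi> (\<lambda>x. ltr h (j + i) x - ltr h k x) (ltr h (- i)) + \<phi> (ltr h k) (\<lambda>x. ltr h (- i) x - ltr h (- k + j) x))
        (2 * e * H + H * (2 * e))"
      by (intro tens_rep_add tens_rep_elem L2_diff ltr_mem d1 d2 ltr_bound)
    then show ?thesis
      by (rule tens_rep_cong) (auto simp: ik bil_diff ltr_mem)
  qed
  show ?thesis
  proof (rule tens_rep_cong[OF tens_rep_weight1[where F = ?F, OF q _ F] _ order_refl])
    fix \<phi> assume "bdd_bilinear \<mu> \<phi>"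
    have m: "(\<lambda>z. \<phi> (ltr h (p z)) (ltr h (- p z + j))) \<in> borel_measurable \<mu>"
      by (intro borel_measurable_simple_function simple_function_compose1[OF p])
    have i: "integrable \<mu> (\<lambda>z. f (r z))" if "simple_function \<mu> r" for r and f :: "'g \<Rightarrow> complex"
      using integral_simple_weighted(1)[OF that, of "\<lambda>_. 1" f] by simp
    have "(\<Sum>i\<in>range p. weight (\<lambda>_. 1) p i * (\<phi> (ltr h (j + i)) (ltr h (- i)) - \<phi> (ltr h i) (ltr h (- i + j))))
        = (\<integral>z. \<phi> (ltr h (j + p z)) (ltr h (- p z)) \<partial>\<mu>) - (\<integral>z. \<phi> (ltr h (p z)) (ltr h (- p z + j)) \<partial>\<mu>)"
      unfolding sum_weight1[OF p]
      by (rule Bochner_Integration.integral_diff) (fact i[OF p])+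
    \<comment> \<open>Left invariance is applied to the second integral alone, which brings in the
      second node \<open>p (j + z)\<close>.\<close>
    also have "(\<integral>z. \<phi> (ltr h (p z)) (ltr h (- p z + j)) \<partial>\<mu>) = (\<integral>z. \<phi> (ltr h (p (j + z))) (ltr h (- p (j + z) + j)) \<partial>\<mu>)"
      using haar_preserving_integral[OF haar_preserving_left[of j] m] by simp
    also have "(\<integral>z. \<phi> (ltr h (j + p z)) (ltr h (- p z)) \<partial>\<mu>) - \<dots>
        = (\<integral>z. ?F (?q z) \<phi> \<partial>\<mu>)"
      by (simp, rule Bochner_Integration.integral_diff[symmetric]) (fact i[OF p] i[OF pj])+
    finally show "(\<Sum>i\<in>range p. weight (\<lambda>_. 1) p i * (\<phi> (ltr h (j + i)) (ltr h (- i)) - \<phi> (ltr h i) (ltr h (- i + j))))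
        = (\<Sum>i\<in>range ?q. weight (\<lambda>_. 1) ?q i * ?F i \<phi>)"
      by (simp only: sum_weight1[OF q])
  qed (use e H in simp)
qed

text \<open>Discretize \<open>a\<close> with the same mesh \<open>p\<close>. The remainders of the
  two legs cost \<open>2 * e * H\<close> and the translates \<open>4 * e * H\<close>, each times the
  integral of \<open>cmod (a z)\<close>, whence the 6.\<close>

lemma commutator_rep:
  "tens_rep (\<lambda>\<phi>. \<Sum>i\<in>range p. weight (\<lambda>_. 1) p i * commutator h a i \<phi>)
    (6 * e * H * (\<integral>z. cmod (a z) \<partial>\<mu>))"
proof -
  let ?A = "\<integral>z. cmod (a z) \<partial>\<mu>"
  have e: "0 \<le> e" using order_trans[OF osc_nonneg[OF h] close] .
  have H: "0 \<le> H" using order_trans[OF abs_ge_zero h_bound] .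
  have A: "0 \<le> ?A" by simp
  let ?R = "\<lambda>\<phi>. \<Sum>i\<in>range p. weight (\<lambda>_. 1) p i * (\<phi> (lrem h a p i) (ltr h (- i)) - \<phi> (ltr h i) (rrem h a p i))"
  let ?E = "\<lambda>j \<phi>. \<Sum>i\<in>range p. weight (\<lambda>_. 1) p i * (\<phi> (ltr h (j + i)) (ltr h (- i)) - \<phi> (ltr h i) (ltr h (- i + j)))"
  have R: "tens_rep ?R ((e * ?A) * H + H * (e * ?A))"
    by (intro tens_rep_weight1[OF p] tens_rep_diff tens_rep_elem rem_L2 ltr_mem lrem_bound rrem_bound ltr_bound)
      (use e H in simp)
  have E: "tens_rep (\<lambda>\<phi>. \<Sum>j\<in>range p. weight a p j * ?E j \<phi>) (?A * (4 * e * H))"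
    by (rule tens_rep_weight[OF p L2_integrable[OF a] _ translate_commutator_rep]) (use e H in simp)
  show ?thesis
  proof (rule tens_rep_cong[OF tens_rep_add[OF R E]])
    fix \<phi> assume \<phi>: "bdd_bilinear \<mu> \<phi>"
    have fin: "finite (range p)" by (rule simple_function_levels(1)[OF p])
    have eqL: "\<phi> (conv \<mu> a (ltr h i)) g = \<phi> (lrem h a p i) g + (\<Sum>j\<in>range p. weight a p j * \<phi> (ltr h (j + i)) g)"
      if g: "g \<in> L2 \<mu>" for i g
    proof -
      have s: "(\<lambda>x. \<Sum>j\<in>range p. weight a p j * ltr h (j + i) x) \<in> L2 \<mu>"
        by (rule bil_sum(1)[OF \<phi> fin ltr_mem g])
      have "conv \<mu> a (ltr h i) = (\<lambda>x. 1 * lrem h a p i x + (\<Sum>j\<in>range p. weight a p j * ltr h (j + i) x))"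
        by (simp add: lrem_def)
      then show ?thesis
        using bil_lincomb(1)[OF \<phi> rem_L2(1) s g, of 1] by (simp add: bil_sum(2)[OF \<phi> fin ltr_mem g])
    qed
    have eqR: "\<phi> g (conv \<mu> (ltr h (- i)) a) = \<phi> g (rrem h a p i) + (\<Sum>j\<in>range p. weight a p j * \<phi> g (ltr h (- i + j)))"
      if g: "g \<in> L2 \<mu>" for i g
    proof -
      have s: "(\<lambda>x. \<Sum>j\<in>range p. weight a p j * ltr h (- i + j) x) \<in> L2 \<mu>"
        by (rule bil_sum(1)[OF \<phi> fin ltr_mem g])
      have "conv \<mu> (ltr h (- i)) a = (\<lambda>x. 1 * rrem h a p i x + (\<Sum>j\<in>range p. weight a p j * ltr h (- i + j) x))"
        by (simp add: rrem_def)
      then show ?thesis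
        using bil_lincomb(2)[OF \<phi> rem_L2(2) s g, of 1] by (simp add: bil_sum(3)[OF \<phi> fin ltr_mem g])
    qed
    have c: "commutator h a i \<phi> = (\<phi> (lrem h a p i) (ltr h (- i)) - \<phi> (ltr h i) (rrem h a p i)) +
        (\<Sum>j\<in>range p. weight a p j * (\<phi> (ltr h (j + i)) (ltr h (- i)) - \<phi> (ltr h i) (ltr h (- i + j))))" for i
      by (simp add: commutator_def eqL eqR ltr_mem right_diff_distrib sum_subtractf)
    \<comment> \<open>For a fixed translation \<open>j\<close> the cancellation takes place in the
      sum over \<open>i\<close>, so that sum has to be the inner one.\<close>
    have "(\<Sum>i\<in>range p. weight (\<lambda>_. 1) p i * (\<Sum>j\<in>range p. weight a p j *
          (\<phi> (ltr h (j + i)) (ltr h (- i)) - \<phi> (ltr h i) (ltr h (- i + j)))))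
        = (\<Sum>j\<in>range p. weight a p j * ?E j \<phi>)"
      unfolding sum_distrib_left by (subst sum.swap) (simp only: mult.left_commute)
    then show "(\<Sum>i\<in>range p. weight (\<lambda>_. 1) p i * commutator h a i \<phi>)
        = ?R \<phi> + (\<Sum>j\<in>range p. weight a p j * ?E j \<phi>)"
      unfolding c distrib_left sum.distrib by simp
  qed (simp add: algebra_simps)
qed

end

end

end

section \<open>Symmetric approximate diagonals\<close>

lemma conv_scale:
  "conv \<mu> a (\<lambda>x. k * f x) = (\<lambda>x. k * conv \<mu> a f x)"
  "conv \<mu> (\<lambda>x. k * f x) a = (\<lambda>x. k * conv \<mu> f a x)"
  by (auto simp: conv_def mult.left_commute mult.assoc)

text \<open>The list of a tensor followed by that of its flip. The scalar sits in the first leg in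
  both halves, so flipping gives an equivalent tensor rather than the same list reordered.\<close>

definition sym_list :: "('i \<Rightarrow> complex) \<Rightarrow> ('i \<Rightarrow> 'g \<Rightarrow> complex) \<Rightarrow> ('i \<Rightarrow> 'g \<Rightarrow> complex) \<Rightarrow> 'i list
    \<Rightarrow> (('g \<Rightarrow> complex) \<times> ('g \<Rightarrow> complex)) list" where
  "sym_list k b c xs = map (\<lambda>i. (\<lambda>x. k i * b i x, c i)) xs @ map (\<lambda>i. (\<lambda>x. k i * c i x, b i)) xs"

context compact_haar
begin

lemma sym_list_tensor:
  fixes k :: "'i \<Rightarrow> complex"
  assumes b: "\<And>i. continuous_on UNIV (b i)" and c: "\<And>i. continuous_on UNIV (c i)"
    and xs: "distinct xs"
  defines "t \<equiv> fin_tens (sym_list k b c xs)"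
  shows sym_list_ok: "tens_ok \<mu> t"
    and sym_list_flip: "tens_equiv \<mu> (flip t) t"
    and sym_list_pi: "tens_pi \<mu> t x = (\<Sum>i\<in>set xs. k i * (conv \<mu> (b i) (c i) x + conv \<mu> (c i) (b i) x))"
    and sym_list_diff_ok: "a \<in> L2 \<mu> \<Longrightarrow> tens_ok \<mu> (tens_diff (lmult \<mu> a t) (rmult \<mu> t a))"
    and sym_list_diff_sum: "\<lbrakk>a \<in> L2 \<mu>; bdd_bilinear \<mu> \<phi>\<rbrakk> \<Longrightarrow>
      (\<Sum>n. \<phi> (fst (tens_diff (lmult \<mu> a t) (rmult \<mu> t a) n)) (snd (tens_diff (lmult \<mu> a t) (rmult \<mu> t a) n)))
      = (\<Sum>i\<in>set xs. k i * ((\<phi> (conv \<mu> a (b i)) (c i) - \<phi> (b i) (conv \<mu> (c i) a))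
          + (\<phi> (conv \<mu> a (c i)) (b i) - \<phi> (c i) (conv \<mu> (b i) a))))"
proof -
  let ?ys = "sym_list k b c xs"
  have bL: "b i \<in> L2 \<mu>" and cL: "c i \<in> L2 \<mu>" for i
    using L2_continuous b c by auto
  have ys: "y \<in> L2 \<mu> \<and> z \<in> L2 \<mu>" if "(y, z) \<in> set ?ys" for y z
    using that bL cL by (auto simp: sym_list_def intro: L2_scale)
  show ok: "tens_ok \<mu> t"
    unfolding t_def by (rule tens_ok_fin_tens[OF ys])
  show "tens_equiv \<mu> (flip t) t"
    unfolding tens_equiv_def
  proof (intro conjI ok allI impI)
    show "tens_ok \<mu> (flip t)"
      unfolding t_def flip_fin_tens using ys by (intro tens_ok_fin_tens) auto
    fix \<phi> assume \<phi>: "bdd_bilinear \<mu> \<phi>"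
    have "(\<Sum>n. \<phi> (fst (fin_tens zs n)) (snd (fin_tens zs n))) = (\<Sum>y\<leftarrow>zs. \<phi> (fst y) (snd y))" for zs
      using fin_tens_sums[of "\<lambda>y. \<phi> (fst y) (snd y)" zs] bil_zero[OF \<phi> L2_zero] by (simp add: sums_iff)
    then show "(\<Sum>n. \<phi> (fst (flip t n)) (snd (flip t n))) = (\<Sum>n. \<phi> (fst (t n)) (snd (t n)))"
      unfolding t_def flip_fin_tens
      by (simp add: sym_list_def comp_def bil_scale[OF \<phi>] bL cL add.commute)
  qed
  have "tens_pi \<mu> t x = (\<Sum>y\<leftarrow>?ys. conv \<mu> (fst y) (snd y) x)"
    using fin_tens_sums[of "\<lambda>y. conv \<mu> (fst y) (snd y) x" ?ys]
    unfolding tens_pi_def t_def by (simp add: sums_iff)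
  then show "tens_pi \<mu> t x = (\<Sum>i\<in>set xs. k i * (conv \<mu> (b i) (c i) x + conv \<mu> (c i) (b i) x))"
    using xs by (simp add: sym_list_def comp_def conv_scale sum_list_distinct_conv_sum_set sum.distrib distrib_left)
  assume a: "a \<in> L2 \<mu>"
  have conv_L2: "conv \<mu> a (b i) \<in> L2 \<mu>" "conv \<mu> a (c i) \<in> L2 \<mu>" "conv \<mu> (b i) a \<in> L2 \<mu>" "conv \<mu> (c i) a \<in> L2 \<mu>" for i
    by (intro L2_continuous continuous_conv_left continuous_conv_right a b c)+
  let ?l = "map (\<lambda>(b, c). (conv \<mu> a b, c)) ?ys" and ?r = "map (\<lambda>(b, c). (b, conv \<mu> c a)) ?ys"
  have l: "y \<in> L2 \<mu> \<and> z \<in> L2 \<mu>" if "(y, z) \<in> set ?l" for y z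
    using that bL cL conv_L2 by (auto simp: sym_list_def conv_scale intro: L2_scale)
  have r: "y \<in> L2 \<mu> \<and> z \<in> L2 \<mu>" if "(y, z) \<in> set ?r" for y z
    using that bL cL conv_L2 by (auto simp: sym_list_def conv_scale intro: L2_scale)
  have lr: "tens_diff (lmult \<mu> a t) (rmult \<mu> t a) = tens_diff (fin_tens ?l) (fin_tens ?r)"
    by (simp add: t_def lmult_fin_tens rmult_fin_tens)
  have sums: "(\<lambda>n. \<Psi> (tens_diff (fin_tens ?l) (fin_tens ?r) n)) sums
      ((\<Sum>y\<leftarrow>?l. \<Psi> y) + (\<Sum>y\<leftarrow>?r. \<Psi> (\<lambda>x. - fst y x, snd y)))" if "\<Psi> (\<lambda>_. 0, \<lambda>_. 0) = 0"
    for \<Psi> :: "('g \<Rightarrow> complex) \<times> ('g \<Rightarrow> complex) \<Rightarrow> 'b::real_normed_vector"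
    using that by (intro tens_diff_sums fin_tens_sums[of "\<lambda>y. \<Psi> (\<lambda>x. - fst y x, snd y)"] fin_tens_sums) simp_all
  have "fst (tens_diff (fin_tens ?l) (fin_tens ?r) n) \<in> L2 \<mu> \<and> snd (tens_diff (fin_tens ?l) (fin_tens ?r) n) \<in> L2 \<mu>" for n
  proof -
    have "tens_ok \<mu> (fin_tens ?l)" "tens_ok \<mu> (fin_tens ?r)"
      by (rule tens_ok_fin_tens, erule l) (rule tens_ok_fin_tens, erule r)
    moreover have "(\<lambda>x. - f x) \<in> L2 \<mu>" if "f \<in> L2 \<mu>" for f
      using L2_scale[OF that, of "- 1"] by simp
    ultimately show ?thesis by (auto simp: tens_ok_def tens_diff_def)
  qed
  moreover have "summable (\<lambda>n. l2norm \<mu> (fst (tens_diff (fin_tens ?l) (fin_tens ?r) n)) *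
      l2norm \<mu> (snd (tens_diff (fin_tens ?l) (fin_tens ?r) n)))"
    using sums_summable[OF sums[of "\<lambda>y. l2norm \<mu> (fst y) * l2norm \<mu> (snd y)"]] by simp
  ultimately show "tens_ok \<mu> (tens_diff (lmult \<mu> a t) (rmult \<mu> t a))"
    unfolding lr tens_ok_def by blast
  assume \<phi>: "bdd_bilinear \<mu> \<phi>"
  have neg: "\<phi> (\<lambda>x. - (k * f x)) g = - k * \<phi> f g" if "f \<in> L2 \<mu>" "g \<in> L2 \<mu>" for f g k
    using bil_scale(1)[OF \<phi> that, of "- k"] by simp
  show "(\<Sum>n. \<phi> (fst (tens_diff (lmult \<mu> a t) (rmult \<mu> t a) n)) (snd (tens_diff (lmult \<mu> a t) (rmult \<mu> t a) n)))
      = (\<Sum>i\<in>set xs. k i * ((\<phi> (conv \<mu> a (b i)) (c i) - \<phi> (b i) (conv \<mu> (c i) a))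
          + (\<phi> (conv \<mu> a (c i)) (b i) - \<phi> (c i) (conv \<mu> (b i) a))))"
    unfolding lr using sums[of "\<lambda>y. \<phi> (fst y) (snd y)"] bil_zero[OF \<phi> L2_zero] xs
    by (simp add: sums_iff sym_list_def comp_def conv_scale bil_scale[OF \<phi>] neg bL cL conv_L2
        sum_list_distinct_conv_sum_set sum.distrib sum_negf algebra_simps sum_subtractf)
qed

context
  fixes h :: "'g \<Rightarrow> real" and H e :: real and p :: "'g \<Rightarrow> 'g"
  assumes h: "continuous_on UNIV h" and central: "\<And>x y. h (x + y) = h (y + x)"
    and h_bound: "\<And>x. \<bar>h x\<bar> \<le> H"
    and p: "simple_function \<mu> p" and close: "\<And>z. osc h (z - p z) \<le> e"
begin

text \<open>The result does not depend on \<open>i\<close>: centrality cancels the opposite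
  translations. Hence a Riemann sum of total mass 1 has product exactly \<open>h * h\<close>,
  whatever the mesh.\<close>

lemma conv_ltr: "conv \<mu> (ltr h i) (ltr h (- i)) x = complex_of_real (\<integral>w. h (x - w) * h w \<partial>\<mu>)"
proof -
  let ?F = "\<lambda>y. ltr h i y * ltr h (- i) (- y + x)"
  have "continuous_on UNIV ?F"
    by (intro continuous_intros ltr_continuous[OF h] continuous_on_shift[OF ltr_continuous[OF h]] group_cont)
  \<comment> \<open>Right invariance, substituting \<open>w + i\<close> for the variable of
    integration.\<close>
  then have "conv \<mu> (ltr h i) (ltr h (- i)) x = (\<integral>w. ?F (w + i) \<partial>\<mu>)"
    unfolding conv_def by (intro haar_preserving_integral[OF haar_preserving_right, symmetric] measurable_continuous)
  moreover have "?F (w + i) = complex_of_real (h (x - w) * h w)" for w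
    using central[of "- i" "w + i"] central[of "- w" x]
    by (simp add: ltr_def group_norm del: add_uminus_conv_diff)
  ultimately show ?thesis by (simp del: of_real_mult)
qed

lemma sum_weight_const: "(\<Sum>i\<in>range p. weight (\<lambda>_. 1) p i * c) = c"
  using sum_weight1[OF p, of "\<lambda>_. c"] by (simp add: measure_UNIV)

text \<open>The flip of the Riemann sum for \<open>p\<close> is the Riemann sum for the reflected
  mesh, which is equally fine. The average of the two is symmetric and obeys the same commutator
  bound.\<close>

lemma near_diagonal:
  obtains t where "tens_ok \<mu> t" "tens_equiv \<mu> (flip t) t"
    "tens_pi \<mu> t = (\<lambda>x. complex_of_real (\<integral>w. h (x - w) * h w \<partial>\<mu>))"
    "\<And>a. a \<in> L2 \<mu> \<Longrightarrow> tens_ok \<mu> (tens_diff (lmult \<mu> a t) (rmult \<mu> t a))"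
    "\<And>a. a \<in> L2 \<mu> \<Longrightarrow> proj_norm \<mu> (tens_diff (lmult \<mu> a t) (rmult \<mu> t a)) \<le> 6 * e * H * (\<integral>z. cmod (a z) \<partial>\<mu>)"
proof -
  obtain xs where xs: "set xs = range p" "distinct xs"
    using finite_distinct_list[OF simple_function_levels(1)[OF p]] by blast
  let ?k = "\<lambda>i. weight (\<lambda>_. 1) p i / 2"
  define t where "t = fin_tens (sym_list ?k (ltr h) (\<lambda>i. ltr h (- i)) xs)"
  note T = sym_list_tensor[where b = "ltr h" and c = "\<lambda>i. ltr h (- i)" and xs = xs and k = ?k, folded t_def,
      OF ltr_continuous[OF h] ltr_continuous[OF h] xs(2), unfolded xs(1)]
  \<comment> \<open>Reflecting argument and value keeps the distance to the node, by
    \<open>osc_flip\<close>.\<close>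
  let ?p = "\<lambda>z. - p (- z)"
  have cu: "continuous_on UNIV (uminus :: 'g \<Rightarrow> 'g)" by (intro group_cont continuous_intros)
  have p': "simple_function \<mu> ?p"
    by (rule simple_function_compose1[OF simple_function_compose_continuous[OF p cu]])
  have close': "osc h (z - ?p z) \<le> e" for z
    using close[of "- z"] osc_flip[OF h, of "- z" "p (- z)"] by simp
  \<comment> \<open>Inversion invariance identifies negated nodes of \<open>p\<close> with nodes of
    the reflected mesh, weights included.\<close>
  have reflect: "(\<Sum>i\<in>range p. weight (\<lambda>_. 1) p i * F (- i)) = (\<Sum>i\<in>range ?p. weight (\<lambda>_. 1) ?p i * F i)" for F :: "'g \<Rightarrow> complex"
  proof -
    have m: "(\<lambda>z. F (- p z)) \<in> borel_measurable \<mu>"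
      by (intro borel_measurable_simple_function simple_function_compose1[OF p])
    show ?thesis
      using haar_preserving_integral[OF haar_preserving_uminus m]
      by (simp add: sum_weight1[OF p] sum_weight1[OF p'])
  qed
  have "tens_pi \<mu> t x = complex_of_real (\<integral>w. h (x - w) * h w \<partial>\<mu>)" for x
    using conv_ltr[of "- i" x for i] sum_weight_const
    by (simp add: T(3) conv_ltr)
  moreover have "proj_norm \<mu> (tens_diff (lmult \<mu> a t) (rmult \<mu> t a)) \<le> 6 * e * H * (\<integral>z. cmod (a z) \<partial>\<mu>)"
    if a: "a \<in> L2 \<mu>" for a
  proof (rule proj_norm_le[OF T(4)[OF a]])
    let ?C = "commutator h a" and ?M = "6 * e * H * (\<integral>z. cmod (a z) \<partial>\<mu>)"
    note rep = commutator_rep[OF h central h_bound a]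
    show "tens_rep (\<lambda>\<phi>. 1 / 2 * ((\<Sum>i\<in>range p. weight (\<lambda>_. 1) p i * ?C i \<phi>)
        + (\<Sum>i\<in>range ?p. weight (\<lambda>_. 1) ?p i * ?C i \<phi>))) ?M"
      by (rule tens_rep_cong[OF tens_rep_scale[OF tens_rep_add[OF rep[OF p close] rep[OF p' close']], of "1 / 2"]])
        simp_all
    fix \<phi> assume "bdd_bilinear \<mu> \<phi>"
    from T(5)[OF a this]
    show "(\<Sum>n. \<phi> (fst (tens_diff (lmult \<mu> a t) (rmult \<mu> t a) n)) (snd (tens_diff (lmult \<mu> a t) (rmult \<mu> t a) n)))
        = 1 / 2 * ((\<Sum>i\<in>range p. weight (\<lambda>_. 1) p i * ?C i \<phi>) + (\<Sum>i\<in>range ?p. weight (\<lambda>_. 1) ?p i * ?C i \<phi>))"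
      unfolding reflect[of "\<lambda>i. ?C i \<phi>", symmetric] sum.distrib[symmetric] sum_distrib_left
      by (simp add: commutator_def distrib_left)
  qed
  ultimately show ?thesis
    using T(1,2,4) by (intro that[of t]) auto
qed

end

section \<open>Central densities near the identity\<close>

text \<open>Finitely many translates of \<open>S\<close> cover the group, and all have the measure
  of \<open>S\<close>; a null set could not produce total mass 1.\<close>

lemma open_measure_pos:
  assumes "open S" "S \<noteq> {}"
  shows "0 < measure \<mu> S"
proof -
  obtain s where s: "s \<in> S" using assms by blast
  have eq: "(+) c ` S = (+) (- c) -` S" for c
    by (auto simp: image_iff intro!: bexI[of _ "- c + x" for x])
  have op: "open ((+) c ` S)" for c
    unfolding eq by (intro open_vimage assms group_cont continuous_intros)
  have "UNIV \<subseteq> (\<Union>c. (+) c ` S)"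
  proof
    fix x
    have "x = (x - s) + s" by simp
    with s show "x \<in> (\<Union>c. (+) c ` S)" by blast
  qed
  then obtain C where C: "finite C" "UNIV \<subseteq> (\<Union>c\<in>C. (+) c ` S)"
    using compactE_image[OF compact_group_UNIV, of UNIV "\<lambda>c. (+) c ` S"] op by metis
  have "emeasure \<mu> UNIV \<le> emeasure \<mu> (\<Union>c\<in>C. (+) c ` S)"
    using C op by (intro emeasure_mono) auto
  also have "\<dots> \<le> (\<Sum>c\<in>C. emeasure \<mu> ((+) c ` S))"
    using C op by (intro emeasure_subadditive_finite) auto
  also have "\<dots> = of_nat (card C) * emeasure \<mu> S"
    using assms by (simp add: emeasure_ltrans)
  finally have "emeasure \<mu> S \<noteq> 0"
    by (auto simp: emeasure_haar_UNIV)
  then show ?thesis by (simp add: emeasure_eq_measure zero_less_measure_iff)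
qed

lemma integral_continuous_pos:
  fixes k :: "'g \<Rightarrow> real"
  assumes k: "continuous_on UNIV k" "\<And>x. 0 \<le> k x" "0 < k x0"
  shows "0 < (\<integral>x. k x \<partial>\<mu>)"
proof -
  let ?S = "{x. k x0 / 2 < k x}"
  have S: "open ?S" by (intro open_Collect_less continuous_intros k)
  have i: "integrable \<mu> (indicat_real ?S)"
    using S by (intro integrable_real_indicator) (auto simp: emeasure_eq_measure)
  have "0 < k x0 / 2 * measure \<mu> ?S"
  proof (intro mult_pos_pos open_measure_pos S)
    have "x0 \<in> ?S" using k(3) by simp
    then show "?S \<noteq> {}" by blast
  qed (use k(3) in simp)
  also have "\<dots> = (\<integral>x. k x0 / 2 * indicat_real ?S x \<partial>\<mu>)" by simp
  also have "\<dots> \<le> (\<integral>x. k x \<partial>\<mu>)"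
  proof (rule integral_mono)
    show "integrable \<mu> (\<lambda>x. k x0 / 2 * indicat_real ?S x)" using i by simp
    show "k x0 / 2 * indicat_real ?S x \<le> k x" for x
      using k(2)[of x] by (simp add: indicator_def)
  qed (rule integrable_continuous[OF k(1)])
  finally show ?thesis .
qed

text \<open>Since \<open>osc\<close> is conjugation invariant, any bump function built from it is central.\<close>

lemma central_density:
  fixes g :: "'i \<Rightarrow> 'g \<Rightarrow> complex"
  assumes A: "finite A" and g: "\<And>a. a \<in> A \<Longrightarrow> continuous_on UNIV (g a)" and e: "e > 0"
  shows "\<exists>h :: 'g \<Rightarrow> real. continuous_on UNIV h \<and> (\<forall>x. 0 \<le> h x) \<and> (\<integral>x. h x \<partial>\<mu>) = 1 \<and>
    (\<forall>x y. h (x + y) = h (y + x)) \<and> (\<forall>a\<in>A. \<forall>x. h x \<noteq> 0 \<longrightarrow> osc (g a) x \<le> e)"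
proof -
  \<comment> \<open>The product vanishes unless every \<open>osc (g a)\<close> is below
    \<open>e\<close>, and equals a power of \<open>e\<close> at the identity.\<close>
  define k where "k x = (\<Prod>a\<in>A. max 0 (e - osc (g a) x))" for x
  have kc: "continuous_on UNIV k"
    unfolding k_def by (intro continuous_intros osc_continuous g)
  have k0: "0 \<le> k x" for x by (simp add: k_def prod_nonneg)
  have "0 < k 0" unfolding k_def using e by (intro prod_pos) (simp add: osc_0 g)
  from integral_continuous_pos[OF kc k0 this] have I: "0 < (\<integral>x. k x \<partial>\<mu>)" .
  show ?thesis
  proof (intro exI[of _ "\<lambda>x. k x / (\<integral>x. k x \<partial>\<mu>)"] conjI allI ballI impI)
    show "continuous_on UNIV (\<lambda>x. k x / (\<integral>x. k x \<partial>\<mu>))"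
      using I by (intro continuous_intros kc) auto
    show "(\<integral>x. k x / (\<integral>x. k x \<partial>\<mu>) \<partial>\<mu>) = 1" using I by simp
    show "k (x + y) / (\<integral>x. k x \<partial>\<mu>) = k (y + x) / (\<integral>x. k x \<partial>\<mu>)" for x y
      unfolding k_def by (simp add: osc_swap[OF g, of _ x y] cong: prod.cong)
    show "osc (g a) x \<le> e" if a: "a \<in> A" and "k x / (\<integral>x. k x \<partial>\<mu>) \<noteq> 0" for a x
    proof -
      have "max 0 (e - osc (g a) x) \<noteq> 0"
        using that A by (auto simp: k_def)
      then show ?thesis by (simp add: max_def split: if_splits)
    qed
  qed (use k0 I in simp)
qed

section \<open>Assembling the approximate diagonal\<close>

text \<open>The clause on \<open>tens_diff\<close> makes the projective norm of the commutator
  nonnegative, so that an upper bound by \<open>e\<close> is a bound on the distance to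
  \<open>0\<close>.\<close>

definition good_tensors :: "('g \<Rightarrow> complex) set \<Rightarrow> real \<Rightarrow> 'g tens set" where
  "good_tensors A e = {t. tens_ok \<mu> t \<and> tens_equiv \<mu> (flip t) t \<and>
     (\<forall>a\<in>L2 \<mu>. tens_ok \<mu> (tens_diff (lmult \<mu> a t) (rmult \<mu> t a))) \<and>
     (\<forall>a\<in>A. proj_norm \<mu> (tens_diff (lmult \<mu> a t) (rmult \<mu> t a)) < e \<and>
       l2norm \<mu> (\<lambda>x. conv \<mu> (tens_pi \<mu> t) a x - a x) < e)}"

lemma good_tensors_nonempty:
  assumes A: "finite A" "A \<subseteq> L2 \<mu>" and e: "e > 0"
  shows "good_tensors A e \<noteq> {}"
proof -
  have "\<forall>a\<in>A. \<exists>g. continuous_on UNIV g \<and> (\<integral>x. (cmod (a x - g x))\<^sup>2 \<partial>\<mu>) < e\<^sup>2 / 12"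
  proof
    fix a assume "a \<in> A"
    then have "L2_approx a" using A(2) by (intro L2_approx) blast
    moreover have "0 < e\<^sup>2 / 12" using e by simp
    ultimately show "\<exists>g. continuous_on UNIV g \<and> (\<integral>x. (cmod (a x - g x))\<^sup>2 \<partial>\<mu>) < e\<^sup>2 / 12"
      unfolding L2_approx_def by blast
  qed
  then obtain g where g: "\<And>a. a \<in> A \<Longrightarrow> continuous_on UNIV (g a)"
      "\<And>a. a \<in> A \<Longrightarrow> (\<integral>x. (cmod (a x - g a x))\<^sup>2 \<partial>\<mu>) < e\<^sup>2 / 12" by metis
  \<comment> \<open>The product of the tensor is \<open>h * h\<close>, whose support lies in the sum
    of two copies of that of \<open>h\<close>; subadditivity of \<open>osc\<close> doubles
    \<open>e / 8\<close> to the \<open>e / 4\<close> required by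
    \<open>conv_density_l2norm\<close>.\<close>
  have e8: "0 < e / 8" using e by simp
  obtain h :: "'g \<Rightarrow> real" where h: "continuous_on UNIV h" "\<And>x. 0 \<le> h x" "(\<integral>x. h x \<partial>\<mu>) = 1"
      "\<And>x y. h (x + y) = h (y + x)" "\<And>a x. \<lbrakk>a \<in> A; h x \<noteq> 0\<rbrakk> \<Longrightarrow> osc (g a) x \<le> e / 8"
    using central_density[of A g "e / 8", OF A(1) g(1) e8] by blast
  obtain H where H: "0 \<le> H" "\<And>x. \<bar>h x\<bar> \<le> H"
    using continuous_bounded[OF h(1)] by (metis real_norm_def)
  let ?N = "\<lambda>a. \<integral>z. cmod (a z) \<partial>\<mu>"
  \<comment> \<open>Summing over \<open>A\<close> gives one mesh for all its elements.\<close>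
  define K where "K = H * (\<Sum>a\<in>A. ?N a)"
  have K: "0 \<le> K" unfolding K_def using H by (intro mult_nonneg_nonneg sum_nonneg) simp_all
  \<comment> \<open>Chosen so that \<open>6 * d * K = e * K / (K + 1) < e\<close>, also when
    \<open>K\<close> is zero.\<close>
  define d where "d = e / (6 * (K + 1))"
  have d: "d > 0" using e K by (simp add: d_def)
  obtain p where p: "simple_function \<mu> p" "\<And>z. osc h (z - p z) \<le> d"
    using simple_function_discretization[OF h(1) d] by metis
  define u where "u x = (\<integral>w. h (x - w) * h w \<partial>\<mu>)" for x
  obtain t where t: "tens_ok \<mu> t" "tens_equiv \<mu> (flip t) t" "tens_pi \<mu> t = (\<lambda>x. complex_of_real (u x))"
    "\<And>a. a \<in> L2 \<mu> \<Longrightarrow> tens_ok \<mu> (tens_diff (lmult \<mu> a t) (rmult \<mu> t a))"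
    "\<And>a. a \<in> L2 \<mu> \<Longrightarrow> proj_norm \<mu> (tens_diff (lmult \<mu> a t) (rmult \<mu> t a)) \<le> 6 * d * H * ?N a"
    using near_diagonal[OF h(1,4) H(2) p] unfolding u_def by blast
  have hi: "integrable \<mu> h" by (rule integrable_continuous[OF h(1)])
  have uc: "continuous_on UNIV u" unfolding u_def by (rule continuous_reflected_conv[OF h(1) hi])
  have u0: "0 \<le> u x" for x
    unfolding u_def using h(2) by (intro Bochner_Integration.integral_nonneg mult_nonneg_nonneg) auto
  have u1: "(\<integral>x. u x \<partial>\<mu>) = 1"
    unfolding u_def by (simp add: integral_reflected_conv[OF h(1) hi] h(3))
  have supp: "osc (g a) x \<le> e / 4" if a: "a \<in> A" and ux: "u x \<noteq> 0" for a x
  proof -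
    have "\<exists>w. h (x - w) * h w \<noteq> 0"
    proof (rule ccontr)
      assume "\<not> ?thesis"
      then have "(\<lambda>w. h (x - w) * h w) = (\<lambda>_. 0)" by blast
      with ux show False by (simp add: u_def)
    qed
    then obtain w where "h (x - w) \<noteq> 0" "h w \<noteq> 0" by auto
    with h(5)[OF a] have "osc (g a) (x - w) \<le> e / 8" "osc (g a) w \<le> e / 8" by auto
    then show ?thesis using osc_add[OF g(1)[OF a], of "x - w" w] by simp
  qed
  have "t \<in> good_tensors A e"
    unfolding good_tensors_def mem_Collect_eq
  proof (intro conjI ballI t(1,2,4))
    fix a assume a: "a \<in> A"
    then have aL: "a \<in> L2 \<mu>" using A by blast
    have "?N a \<le> (\<Sum>a\<in>A. ?N a)"
      using A(1) a by (intro member_le_sum) auto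
    then have "6 * d * H * ?N a \<le> 6 * d * K"
      unfolding K_def using d H by (simp add: mult.assoc mult_left_mono)
    also have "\<dots> < e" using e K by (simp add: d_def field_simps)
    finally show "proj_norm \<mu> (tens_diff (lmult \<mu> a t) (rmult \<mu> t a)) < e"
      using t(5)[OF aL] by simp
    show "l2norm \<mu> (\<lambda>x. conv \<mu> (tens_pi \<mu> t) a x - a x) < e"
      unfolding t(3) by (rule conv_density_l2norm[OF uc u0 u1 aL g(1)[OF a] e g(2)[OF a] supp[OF a]])
  qed
  then show ?thesis by blast
qed

text \<open>The filter is generated by the sets \<open>good_tensors A e\<close> over finite
  \<open>A\<close> and positive \<open>e\<close>. They are nonempty and directed, so the filter is
  proper, and each single \<open>a\<close> is reached through \<open>A = {a}\<close>.\<close>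

lemma sym_pseudo_amenable: "sym_pseudo_amenable_L2 \<mu>"
proof -
  define I where "I = {(A, e :: real). finite A \<and> A \<subseteq> L2 \<mu> \<and> e > 0}"
  define F where "F = (INF (A, e)\<in>I. principal (good_tensors A e))"
  have ev: "\<forall>\<^sub>F t in F. t \<in> good_tensors A e" if "finite A" "A \<subseteq> L2 \<mu>" "e > 0" for A e
    unfolding F_def using that
    by (intro eventually_INF1[of "(A, e)"]) (auto simp: I_def eventually_principal)
  have "F \<noteq> bot"
    unfolding F_def
  proof (subst INF_filter_bot_base)
    fix i j assume "i \<in> I" "j \<in> I"
    then obtain A d B e where ij: "i = (A, d)" "j = (B, e)" "finite A" "A \<subseteq> L2 \<mu>" "d > 0"
      "finite B" "B \<subseteq> L2 \<mu>" "e > 0" by (auto simp: I_def)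
    \<comment> \<open>More elements and a smaller tolerance give a smaller set, so the union and the
      minimum serve.\<close>
    then show "\<exists>k\<in>I. (case k of (A, e) \<Rightarrow> principal (good_tensors A e))
        \<le> inf (case i of (A, e) \<Rightarrow> principal (good_tensors A e)) (case j of (A, e) \<Rightarrow> principal (good_tensors A e))"
      by (intro bexI[of _ "(A \<union> B, min d e)"]) (auto simp: I_def good_tensors_def)
  next
    have "good_tensors A e \<noteq> {}" if "(A, e) \<in> I" for A e
      using that by (intro good_tensors_nonempty) (auto simp: I_def)
    then show "\<not> (\<exists>i\<in>I. (case i of (A, e) \<Rightarrow> principal (good_tensors A e)) = bot)"
      by (auto simp: principal_eq_bot_iff)
  qed
  moreover have "\<forall>\<^sub>F t in F. tens_ok \<mu> t \<and> tens_equiv \<mu> (flip t) t"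
    using ev[of "{}" 1] by (rule eventually_mono) (auto simp: good_tensors_def)
  moreover have "((\<lambda>t. proj_norm \<mu> (tens_diff (lmult \<mu> a t) (rmult \<mu> t a))) \<longlongrightarrow> 0) F"
      "((\<lambda>t. l2norm \<mu> (\<lambda>x. conv \<mu> (tens_pi \<mu> t) a x - a x)) \<longlongrightarrow> 0) F" if a: "a \<in> L2 \<mu>" for a
  proof -
    have *: "\<forall>\<^sub>F t in F. t \<in> good_tensors {a} e" if "e > 0" for e
      using ev[of "{a}" e] that a by simp
    show "((\<lambda>t. proj_norm \<mu> (tens_diff (lmult \<mu> a t) (rmult \<mu> t a))) \<longlongrightarrow> 0) F"
    proof (rule tendstoI)
      fix e :: real assume "e > 0"
      from *[OF this] show "\<forall>\<^sub>F t in F. dist (proj_norm \<mu> (tens_diff (lmult \<mu> a t) (rmult \<mu> t a))) 0 < e"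
        by (rule eventually_mono) (use a in \<open>auto simp: good_tensors_def abs_of_nonneg proj_norm_nonneg\<close>)
    qed
    show "((\<lambda>t. l2norm \<mu> (\<lambda>x. conv \<mu> (tens_pi \<mu> t) a x - a x)) \<longlongrightarrow> 0) F"
    proof (rule tendstoI)
      fix e :: real assume "e > 0"
      from *[OF this] show "\<forall>\<^sub>F t in F. dist (l2norm \<mu> (\<lambda>x. conv \<mu> (tens_pi \<mu> t) a x - a x)) 0 < e"
        by (rule eventually_mono) (auto simp: good_tensors_def abs_of_nonneg l2norm_nonneg)
    qed
  qed
  ultimately show ?thesis unfolding sym_pseudo_amenable_L2_def by blast
qed

end

theorem theorem4p3:
  fixes \<mu> :: "'g::{group_add, t2_space} measure"
  assumes "compact_group TYPE('g)"
    and "haar_prob \<mu>"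
  shows "sym_pseudo_amenable_L2 \<mu>"
proof -
  interpret compact_haar \<mu> using assms by unfold_locales
  show ?thesis by (rule sym_pseudo_amenable)
qed

end
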